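(* For every integer $M\ge2$, let $C_M(\mathrm{SNR})$ be the capacity, in nats per symbol, of $M$-ary PSK with hard-decision detection over the noncoherent Rician fading channel whose fading coefficients have mean $d\neq 0$ and variance $\gamma^2$ (defined in the context). Then the first and second (one-sided) derivatives of $C_M(\mathrm{SNR})$ with respect to $\mathrm{SNR}$ at $\mathrm{SNR}=0$ are $$\dot{C}_M(0) = \begin{cases} \dfrac{2|d|^2}{\pi} & M = 2,\\[4pt] \dfrac{M^2|d|^2}{4\pi}\sin^2\dfrac{\pi}{M} & M \ge 3,\end{cases}$$ and $$\ddot{C}_M(0) = \begin{cases} \dfrac{8}{3\pi}\left(\dfrac{1}{\pi}-1\right)|d|^4-\dfrac{4|d|^2\gamma^2}{\pi} & M=2,\\[4pt] \infty & M = 3,\\[4pt] \dfrac{4}{3\pi}\left(\dfrac{1}{\pi}-1\right)|d|^4-\dfrac{4|d|^2\gamma^2}{\pi} & M=4,\\[4pt] \psi(M)|d|^4-\dfrac{|d|^2\gamma^2}{2\pi}M^2\sin^2\dfrac{\pi}{M} & M\ge 5,\end{cases}$$ where $$\psi(M) = \frac{M^2}{16\pi^2}\left((2-\pi)\sin^2\frac{2\pi}{M} + (M^2-4\pi)\sin^4\frac{\pi}{M} - 2M\sin^2\frac{\pi}{M}\sin\frac{2\pi}{M}\right).$$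
   Context: Noncoherent Rician fading channel with $M$-ary PSK and hard decisions: the input is $x\in\{0,\dots,M-1\}$; when $x=m$ the transmitted signal is $s_m=\sqrt{\mathcal{E}}\,e^{j2\pi m/M}$, and the received signal is $r=hs_m+n$, where $n$ is zero-mean circularly symmetric complex Gaussian with $E\{|n|^2\}=N_0>0$, and the fading coefficient $h$ (i.i.d. from symbol to symbol, independent of the noise and input, unknown to both transmitter and receiver) is proper complex Gaussian with mean $E\{h\}=d\ne0$ and variance $E\{|h-d|^2\}=\gamma^2$. Thus, in the paper's normalization, where $\gamma^2$ is measured relative to unit noise variance after scaling by $N_0$, the conditional density of $r$ is $$f_{r|s_m}(r|s_m)=\frac{1}{\pi(\gamma^2|s_m|^2+N_0)}\,e^{-\frac{|r-ds_m|^2}{\gamma^2|s_m|^2+N_0}}.$$ Set $\mathrm{SNR}=\mathcal{E}/N_0$. The maximum likelihood detector outputs $y=l$ when the phase $\theta$ of $r$, measured relative to the phase of $d$, satisfies $(2l-1)\pi/M\le\theta<(2l+1)\pi/M$ (angles modulo $2\pi$). Let $P_{l,0}=P(y=l\mid x=0)$; equivalently $P_{l,0}$ is the probability that $\sqrt{\frac{|d|^2\mathrm{SNR}}{\gamma^2\mathrm{SNR}+1}}+w$ lies in the sector $\{\rho e^{j\theta}:(2l-1)\pi/M\le\theta<(2l+1)\pi/M\}$, where $w$ has density $\frac1\pi e^{-|w|^2}$ on $\mathbb{C}$. The capacity in nats per symbol (natural logarithm) is $$C_M(\mathrm{SNR})=\log M+\sum_{l=0}^{M-1}P_{l,0}\log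 P_{l,0},\qquad \mathrm{SNR}\ge 0.$$ Derivatives at $\mathrm{SNR}=0$ are one-sided (right) derivatives: $\ddot C_M(0)$ is the right derivative at $0$ of $\dot C_M$, with value $\infty$ meaning that the difference quotient tends to $+\infty$. *)

theory Defs
  imports "HOL-Analysis.Analysis"
begin

definition psk_signal :: "nat \<Rightarrow> real \<Rightarrow> nat \<Rightarrow> complex" where
  "psk_signal M E m = complex_of_real (sqrt E) * cis (2 * pi * real m / real M)"

text \<open>Conditional density, with respect to Lebesgue measure on the complex plane, of
  \<open>r = h s + n\<close> given \<open>s\<close>, where \<open>h\<close> and \<open>n\<close> are independent circularly symmetric complex
  Gaussians with means \<open>d\<close> and \<open>0\<close> and variances \<open>\<gamma>\<^sup>2\<close> and \<open>N0\<close>.\<close>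

definition rician_density :: "complex \<Rightarrow> real \<Rightarrow> real \<Rightarrow> complex \<Rightarrow> complex \<Rightarrow> real" where
  "rician_density d \<gamma> N0 s r =
     1 / (pi * (\<gamma>\<^sup>2 * (cmod s)\<^sup>2 + N0)) *
     exp (- ((cmod (r - d * s))\<^sup>2 / (\<gamma>\<^sup>2 * (cmod s)\<^sup>2 + N0)))"

text \<open>The sector of points whose phase relative to the phase of \<open>d\<close> has a representative modulo
  \<open>2\<pi>\<close> in the interval \<open>[(2l - 1)\<pi>/M, (2l + 1)\<pi>/M)\<close>.  The origin lies in every sector, but it
  is a null set.\<close>

definition decision_region :: "nat \<Rightarrow> complex \<Rightarrow> nat \<Rightarrow> complex set" where
  "decision_region M d l =
     {r. \<exists>\<theta>. (2 * real l - 1) * pi / real M \<le> \<theta> \<and> \<theta> < (2 * real l + 1) * pi / real M \<and>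
             r = complex_of_real (cmod r) * cis (Arg d + \<theta>)}"

text \<open>The probability of the detector output \<open>y = l\<close> given the input \<open>x = m\<close>.\<close>

definition psk_trans_prob ::
    "nat \<Rightarrow> complex \<Rightarrow> real \<Rightarrow> real \<Rightarrow> real \<Rightarrow> nat \<Rightarrow> nat \<Rightarrow> real" where
  "psk_trans_prob M d \<gamma> E N0 l m =
     measure (density lborel (\<lambda>r. ennreal (rician_density d \<gamma> N0 (psk_signal M E m) r)))
       (decision_region M d l)"

text \<open>Capacity in nats per symbol as a function of the signal-to-noise ratio \<open>snr = E / N0\<close>,
  that is, with signal energy \<open>E = snr * N0\<close>.\<close>

definition psk_capacity :: "nat \<Rightarrow> complex \<Rightarrow> real \<Rightarrow> real \<Rightarrow> real \<Rightarrow> real" where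
  "psk_capacity M d \<gamma> N0 snr =
     ln (real M) +
     (\<Sum>l<M. psk_trans_prob M d \<gamma> (snr * N0) N0 l 0 * ln (psk_trans_prob M d \<gamma> (snr * N0) N0 l 0))"

definition psk_psi :: "nat \<Rightarrow> real" where
  "psk_psi M =
     (real M)\<^sup>2 / (16 * pi\<^sup>2) *
     ((2 - pi) * (sin (2 * pi / real M))\<^sup>2
      + ((real M)\<^sup>2 - 4 * pi) * (sin (pi / real M)) ^ 4
      - 2 * real M * (sin (pi / real M))\<^sup>2 * sin (2 * pi / real M))"

end

theory Submission
  imports Defs "HOL-Probability.Probability"
begin

text \<open>
  After rotating and rescaling, the transition probabilities are the masses \<open>G\<^sub>l a\<close> of sectors
  under a unit complex Gaussian centred at \<open>a = \<bar>d\<bar> sqrt (snr / (\<gamma>\<^sup>2 snr + 1))\<close>.  In polar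
  coordinates \<open>G\<^sub>l a\<close> is the integral of an explicit phase density over an interval, and the
  derivative of that density with respect to \<open>a\<close> is the derivative of an explicit flux with
  respect to the phase.  Hence \<open>G\<^sub>l'\<close> is a difference of boundary fluxes and has an explicit
  expansion up to \<open>o(a\<^sup>2)\<close>.  Since the \<open>G\<^sub>l'\<close> sum to zero, the derivative of the
  information in \<open>a\<close> is \<open>\<Sum> G\<^sub>l' ln (M G\<^sub>l) = K0 a + K1 a\<^sup>2 + K2 a\<^sup>3 + o(a\<^sup>3)\<close>, where the
  coefficients are sums of trigonometric polynomials over the \<open>M\<close>-th roots of unity.  As \<open>a\<close> is of
  order \<open>sqrt snr\<close>, the second derivative is finite exactly if \<open>K1 = 0\<close>; among \<open>M \<ge> 2\<close>,
  only \<open>M = 3\<close> has \<open>K1 \<noteq> 0\<close>.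
\<close>

section \<open>Lebesgue measure on the complex plane\<close>

text \<open>The flux comes from the divergence theorem. Moving the centre a of the Gaussian along
  the real axis changes its density by minus its derivative in the real direction, so the mass of a
  sector changes by what crosses its two edges. On the ray of angle \<theta> the normal component of
  this motion is, up to sign, sin \<theta>, and exp (-|z - a|^2) integrates along the ray to exp
  (-(a sin \<theta>)^2) (sqrt pi / 2 + \<open>gauss_primitive\<close> (a cos \<theta>)); the product
  is \<open>phase_flux\<close>. A remainder o(x^n) can be integrated but not differentiated. Hence
  only derivatives are expanded directly, and probabilities and logarithms are recovered from them
  by integration. Since a^2 is proportional to snr to leading order, the derivative in snr is, up to
  a smooth factor, the derivative in a divided by a; this quotient is what gets expanded. Its even
  coefficients involve the harmonics 0, 2, 4 of the angle 2 pi l / M, its odd one the harmonics 1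
  and 3. Harmonic k survives summation over l only if M divides k, which singles out M = 2, 3,
  4.\<close>

lemma measurable_Complex [measurable]:
  "(\<lambda>p. Complex (fst p) (snd p)) \<in> borel_measurable (borel \<Otimes>\<^sub>M borel)"
proof -
  have "(\<lambda>p. Complex (fst p) (snd p)) = (\<lambda>p. complex_of_real (fst p) + \<i> * complex_of_real (snd p))"
    by (simp add: complex_eq_iff fun_eq_iff)
  then show ?thesis by simp
qed

text \<open>Lebesgue measure is determined by its values on open boxes, and since
  \<open>Basis\<close> is {1, \<i>}, these are products of two intervals.\<close>

lemma lborel_complex:
  "(lborel :: complex measure) = distr (lborel \<Otimes>\<^sub>M lborel) borel (\<lambda>p. Complex (fst p) (snd p))"
proof (rule lborel_eqI)
  fix l u :: complex
  assume *: "\<And>b. b \<in> Basis \<Longrightarrow> l \<bullet> b \<le> u \<bullet> b"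
  have le: "Re l \<le> Re u" "Im l \<le> Im u"
    using *[of 1] *[of \<i>] by (auto simp: Basis_complex_def)
  have "(\<lambda>p. Complex (fst p) (snd p)) -` box l u \<inter> space (lborel \<Otimes>\<^sub>M lborel)
      = {Re l<..<Re u} \<times> {Im l<..<Im u}"
    by (auto simp: box_def Basis_complex_def space_pair_measure)
  then have "emeasure (distr (lborel \<Otimes>\<^sub>M lborel) borel (\<lambda>p. Complex (fst p) (snd p))) (box l u)
      = emeasure lborel {Re l<..<Re u} * emeasure lborel {Im l<..<Im u}"
    by (subst emeasure_distr) (auto simp: lborel.emeasure_pair_measure_Times)
  also have "\<dots> = ennreal (Re u - Re l) * ennreal (Im u - Im l)"
    using le by simp
  also have "\<dots> = ennreal (\<Prod>b\<in>Basis. (u - l) \<bullet> b)"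
    using le by (simp add: Basis_complex_def ennreal_mult')
  finally show "emeasure (distr (lborel \<Otimes>\<^sub>M lborel) borel (\<lambda>p. Complex (fst p) (snd p))) (box l u)
      = (\<Prod>b\<in>Basis. (u - l) \<bullet> b)" .
qed simp

text \<open>Both orders of integration are recorded because the linear substitution below changes
  the imaginary coordinate for fixed real part and the real coordinate for fixed imaginary
  part.\<close>

lemma
  fixes f :: "complex \<Rightarrow> ennreal"
  assumes [measurable]: "f \<in> borel_measurable borel"
  shows nn_integral_complex: "(\<integral>\<^sup>+z. f z \<partial>lborel) = (\<integral>\<^sup>+x. \<integral>\<^sup>+y. f (Complex x y) \<partial>lborel \<partial>lborel)"
    and nn_integral_complex': "(\<integral>\<^sup>+z. f z \<partial>lborel) = (\<integral>\<^sup>+y. \<integral>\<^sup>+x. f (Complex x y) \<partial>lborel \<partial>lborel)"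
proof -
  have [measurable]: "(\<lambda>p. f (Complex (fst p) (snd p))) \<in> borel_measurable (borel \<Otimes>\<^sub>M borel)"
    by measurable
  have "(\<integral>\<^sup>+z. f z \<partial>lborel) = (\<integral>\<^sup>+p. f (Complex (fst p) (snd p)) \<partial>(lborel \<Otimes>\<^sub>M lborel))"
    by (subst lborel_complex, subst nn_integral_distr) auto
  also have "\<dots> = (\<integral>\<^sup>+x. \<integral>\<^sup>+y. f (Complex x y) \<partial>lborel \<partial>lborel)"
    by (subst lborel.nn_integral_fst[symmetric]) auto
  finally show *: "(\<integral>\<^sup>+z. f z \<partial>lborel) = (\<integral>\<^sup>+x. \<integral>\<^sup>+y. f (Complex x y) \<partial>lborel \<partial>lborel)" .
  also have "\<dots> = (\<integral>\<^sup>+y. \<integral>\<^sup>+x. f (Complex x y) \<partial>lborel \<partial>lborel)"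
    by (rule lborel_pair.Fubini'[symmetric]) (simp add: split_beta')
  finally show "(\<integral>\<^sup>+z. f z \<partial>lborel) = (\<integral>\<^sup>+y. \<integral>\<^sup>+x. f (Complex x y) \<partial>lborel \<partial>lborel)" .
qed

lemma measurable_Complex2 [measurable (raw)]:
  assumes "f \<in> borel_measurable N" "g \<in> borel_measurable N"
  shows "(\<lambda>x. Complex (f x) (g x)) \<in> borel_measurable N"
  using measurable_compose[OF measurable_Pair[OF assms] measurable_Complex] by simp

text \<open>Multiplication by \<open>c\<close> is a product of two axis-parallel affine maps if \<open>Re c \<noteq> 0\<close>.\<close>

lemma nn_integral_complex_mult_aux:
  fixes f :: "complex \<Rightarrow> ennreal"
  assumes [measurable]: "f \<in> borel_measurable borel" and c: "Re c \<noteq> 0"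
  shows "(\<integral>\<^sup>+z. f z \<partial>lborel) = ennreal ((cmod c)\<^sup>2) * (\<integral>\<^sup>+z. f (c * z) \<partial>lborel)"
proof -
  define p q where "p = Re c" and "q = Im c"
  have p: "p \<noteq> 0" and pq: "p\<^sup>2 + q\<^sup>2 \<noteq> 0"
    using c by (simp_all add: p_def add_nonneg_eq_0_iff)
  have "(\<integral>\<^sup>+z. f z \<partial>lborel) = (\<integral>\<^sup>+x. \<integral>\<^sup>+y. f (Complex x y) \<partial>lborel \<partial>lborel)"
    by (rule nn_integral_complex) simp
  also have "\<dots> = (\<integral>\<^sup>+x. \<integral>\<^sup>+y. ennreal \<bar>(p\<^sup>2 + q\<^sup>2) / p\<bar> *
        f (Complex x (q / p * x + (p\<^sup>2 + q\<^sup>2) / p * y)) \<partial>lborel \<partial>lborel)"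
  proof (rule nn_integral_cong)
    fix x :: real
    have "(\<integral>\<^sup>+y. f (Complex x y) \<partial>lborel) = ennreal \<bar>(p\<^sup>2 + q\<^sup>2) / p\<bar> *
        (\<integral>\<^sup>+y. f (Complex x (q / p * x + (p\<^sup>2 + q\<^sup>2) / p * y)) \<partial>lborel)"
      by (rule nn_integral_real_affine) (use p pq in auto)
    then show "(\<integral>\<^sup>+y. f (Complex x y) \<partial>lborel) = (\<integral>\<^sup>+y. ennreal \<bar>(p\<^sup>2 + q\<^sup>2) / p\<bar> *
        f (Complex x (q / p * x + (p\<^sup>2 + q\<^sup>2) / p * y)) \<partial>lborel)"
      by (simp add: nn_integral_cmult)
  qed
  also have "\<dots> = (\<integral>\<^sup>+y. \<integral>\<^sup>+x. ennreal \<bar>(p\<^sup>2 + q\<^sup>2) / p\<bar> *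
        f (Complex x (q / p * x + (p\<^sup>2 + q\<^sup>2) / p * y)) \<partial>lborel \<partial>lborel)"
    by (rule lborel_pair.Fubini'[symmetric]) (simp add: split_beta')
  also have "\<dots> = (\<integral>\<^sup>+y. \<integral>\<^sup>+x. ennreal (p\<^sup>2 + q\<^sup>2) * f (c * Complex x y) \<partial>lborel \<partial>lborel)"
  proof (rule nn_integral_cong)
    fix y :: real
    let ?g = "\<lambda>x. ennreal \<bar>(p\<^sup>2 + q\<^sup>2) / p\<bar> * f (Complex x (q / p * x + (p\<^sup>2 + q\<^sup>2) / p * y))"
    \<comment> \<open>The imaginary part q x + p y of c z, expressed through the real part X = p x -
      q y, is (q / p) X + ((p^2 + q^2) / p) y; this dictates the two substitutions. Their factors
      (p^2 + q^2) / |p| and |p| multiply to the Jacobian p^2 + q^2.\<close>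
    have eq: "Complex (- q * y + p * x) (q / p * (- q * y + p * x) + (p\<^sup>2 + q\<^sup>2) / p * y) = c * Complex x y"
      for x
      using p by (simp add: complex_eq_iff p_def[symmetric] q_def[symmetric] field_simps power2_eq_square)
    have "(\<integral>\<^sup>+x. ?g x \<partial>lborel) = ennreal \<bar>p\<bar> * (\<integral>\<^sup>+x. ?g (- q * y + p * x) \<partial>lborel)"
      by (rule nn_integral_real_affine) (use p in auto)
    also have "\<dots> = (\<integral>\<^sup>+x. ennreal \<bar>p\<bar> * ?g (- q * y + p * x) \<partial>lborel)"
      by (rule nn_integral_cmult[symmetric]) simp
    also have "\<dots> = (\<integral>\<^sup>+x. ennreal (p\<^sup>2 + q\<^sup>2) * f (c * Complex x y) \<partial>lborel)"
      unfolding eq using p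
      by (intro nn_integral_cong) (simp add: mult.assoc[symmetric] ennreal_mult'[symmetric] abs_mult[symmetric])
    finally show "(\<integral>\<^sup>+x. ?g x \<partial>lborel) = \<dots>" .
  qed
  also have "\<dots> = (\<integral>\<^sup>+z. ennreal (p\<^sup>2 + q\<^sup>2) * f (c * z) \<partial>lborel)"
    by (rule nn_integral_complex'[symmetric]) simp
  also have "\<dots> = ennreal ((cmod c)\<^sup>2) * (\<integral>\<^sup>+z. f (c * z) \<partial>lborel)"
    by (simp add: nn_integral_cmult cmod_power2 p_def q_def)
  finally show ?thesis .
qed

text \<open>A purely imaginary c is the product of 1 + \<i> and c / (1 + \<i>), both of which have
  nonzero real part, so two applications of the previous lemma suffice.\<close>

lemma nn_integral_complex_mult:
  fixes f :: "complex \<Rightarrow> ennreal"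
  assumes [measurable]: "f \<in> borel_measurable borel" and c: "c \<noteq> 0"
  shows "(\<integral>\<^sup>+z. f z \<partial>lborel) = ennreal ((cmod c)\<^sup>2) * (\<integral>\<^sup>+z. f (c * z) \<partial>lborel)"
proof (cases "Re c = 0")
  case False
  then show ?thesis by (rule nn_integral_complex_mult_aux[rotated]) simp
next
  case True
  let ?a = "Complex 1 1" and ?b = "c / Complex 1 1"
  have b: "Re ?b \<noteq> 0"
    using True c by (auto simp: complex_eq_iff Re_divide)
  have ab: "?a * (?b * z) = c * z" for z
    by (simp add: complex_eq_iff)
  have "(\<integral>\<^sup>+z. f z \<partial>lborel) = ennreal ((cmod ?a)\<^sup>2) * (\<integral>\<^sup>+z. f (?a * z) \<partial>lborel)"
    by (rule nn_integral_complex_mult_aux) auto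
  also have "(\<integral>\<^sup>+z. f (?a * z) \<partial>lborel) = ennreal ((cmod ?b)\<^sup>2) * (\<integral>\<^sup>+z. f (?a * (?b * z)) \<partial>lborel)"
    by (rule nn_integral_complex_mult_aux) (use b in auto)
  also have "ennreal ((cmod ?a)\<^sup>2) * (ennreal ((cmod ?b)\<^sup>2) * (\<integral>\<^sup>+z. f (?a * (?b * z)) \<partial>lborel)) =
     ennreal ((cmod (?a * ?b))\<^sup>2) * (\<integral>\<^sup>+z. f (?a * (?b * z)) \<partial>lborel)"
    by (simp only: norm_mult power_mult_distrib mult.assoc[symmetric] ennreal_mult' zero_le_power2)
  also have "?a * ?b = c" by (simp add: complex_eq_iff)
  finally show ?thesis unfolding ab .
qed

section \<open>Polar coordinates on sectors\<close>

text \<open>The phase is an arbitrary real representative instead of \<open>Arg z\<close>, so that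
  rotation merely shifts the bounds, with no reduction modulo 2 pi. Leaving out the origin makes
  adjacent sectors disjoint.\<close>

definition sector :: "real \<Rightarrow> real \<Rightarrow> complex set" where
  "sector \<alpha> \<beta> = {z. z \<noteq> 0 \<and> (\<exists>\<theta>. \<alpha> \<le> \<theta> \<and> \<theta> < \<beta> \<and> z = complex_of_real (cmod z) * cis \<theta>)}"

lemma sector_rotate: "cis \<tau> * z \<in> sector \<alpha> \<beta> \<longleftrightarrow> z \<in> sector (\<alpha> - \<tau>) (\<beta> - \<tau>)"
proof -
  have eq: "cis \<tau> * z = complex_of_real (cmod z) * cis \<theta> \<longleftrightarrow> z = complex_of_real (cmod z) * cis (\<theta> - \<tau>)" for \<theta>
  proof -
    have "complex_of_real (cmod z) * cis \<theta> = cis \<tau> * (complex_of_real (cmod z) * cis (\<theta> - \<tau>))"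
      by (simp add: mult.left_commute[of "cis \<tau>"] cis_mult)
    then show ?thesis
      by (simp only: mult_cancel_left cis_neq_zero simp_thms)
  qed
  have "(\<exists>\<theta>. \<alpha> \<le> \<theta> \<and> \<theta> < \<beta> \<and> cis \<tau> * z = complex_of_real (cmod z) * cis \<theta>) \<longleftrightarrow>
      (\<exists>\<theta>. \<alpha> - \<tau> \<le> \<theta> \<and> \<theta> < \<beta> - \<tau> \<and> z = complex_of_real (cmod z) * cis \<theta>)"
    (is "?L = ?R")
  proof
    assume ?L
    then obtain \<theta> where "\<alpha> \<le> \<theta>" "\<theta> < \<beta>" "z = complex_of_real (cmod z) * cis (\<theta> - \<tau>)"
      unfolding eq by blast
    then show ?R by (intro exI[of _ "\<theta> - \<tau>"]) simp
  next
    assume ?R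
    then obtain \<theta> where "\<alpha> - \<tau> \<le> \<theta>" "\<theta> < \<beta> - \<tau>" "z = complex_of_real (cmod z) * cis (\<theta> + \<tau> - \<tau>)"
      by auto
    then show ?L unfolding eq by (intro exI[of _ "\<theta> + \<tau>"]) auto
  qed
  then show ?thesis by (simp add: sector_def norm_mult)
qed

text \<open>Inside the right half plane the slope Im z / Re z is the tangent of the phase, and tan
  is increasing there. The linear inequalities give measurability and prepare the substitution y = x
  tan \<theta>.\<close>

lemma sector_symmetric:
  assumes "0 < \<delta>" "\<delta> < pi / 2"
  shows "sector (- \<delta>) \<delta> = {z. 0 < Re z \<and> - tan \<delta> * Re z \<le> Im z \<and> Im z < tan \<delta> * Re z}"
proof (intro set_eqI iffI)
  fix z assume "z \<in> sector (- \<delta>) \<delta>"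
  then obtain \<theta> where z: "z \<noteq> 0" "- \<delta> \<le> \<theta>" "\<theta> < \<delta>" "z = complex_of_real (cmod z) * cis \<theta>"
    by (auto simp: sector_def)
  have c: "0 < cos \<theta>" using z assms by (intro cos_gt_zero_pi) auto
  have ReIm: "Re z = cmod z * cos \<theta>" "Im z = cmod z * sin \<theta>"
    using arg_cong[OF z(4), of Re] arg_cong[OF z(4), of Im] by simp_all
  have Im: "Im z = tan \<theta> * Re z" using c by (simp add: ReIm tan_def)
  have Re: "0 < Re z" using c z(1) by (simp add: ReIm)
  have "tan \<theta> < tan \<delta>" using z assms by (intro tan_monotone) auto
  moreover have "- tan \<delta> \<le> tan \<theta>"
    using tan_mono_le[of "- \<delta>" \<theta>] z assms by auto
  ultimately show "z \<in> {z. 0 < Re z \<and> - tan \<delta> * Re z \<le> Im z \<and> Im z < tan \<delta> * Re z}"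
    using Re mult_right_mono[of "- tan \<delta>" "tan \<theta>" "Re z"] by (simp add: Im)
next
  fix z assume "z \<in> {z. 0 < Re z \<and> - tan \<delta> * Re z \<le> Im z \<and> Im z < tan \<delta> * Re z}"
  then have z: "0 < Re z" "- tan \<delta> * Re z \<le> Im z" "Im z < tan \<delta> * Re z" by auto
  define \<theta> where "\<theta> = arctan (Im z / Re z)"
  have t: "Im z = tan \<theta> * Re z" and c: "0 < cos \<theta>"
    using z(1) by (simp_all add: \<theta>_def tan_arctan cos_arctan add_pos_nonneg)
  have "arctan (- tan \<delta>) \<le> \<theta>" "\<theta> < arctan (tan \<delta>)"
    using z unfolding \<theta>_def arctan_le_iff arctan_less_iff by (simp_all add: field_simps)
  then have "- \<delta> \<le> \<theta>" "\<theta> < \<delta>"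
    using assms by (simp_all add: arctan_minus arctan_tan)
  moreover have "cmod z = Re z / cos \<theta>"
  proof -
    have "(Re z)\<^sup>2 + (Im z)\<^sup>2 = (Re z / cos \<theta>)\<^sup>2"
    proof -
      have "(Re z)\<^sup>2 + (Im z)\<^sup>2 = (Re z / cos \<theta>)\<^sup>2 * ((cos \<theta>)\<^sup>2 + (sin \<theta>)\<^sup>2)"
        using c by (simp add: t tan_def power_divide power_mult_distrib distrib_left
          del: sin_cos_squared_add sin_cos_squared_add2)
      then show ?thesis by simp
    qed
    then show ?thesis using z(1) c by (simp add: cmod_def)
  qed
  then have "z = complex_of_real (cmod z) * cis \<theta>"
    using c t by (simp add: complex_eq_iff tan_def)
  ultimately show "z \<in> sector (- \<delta>) \<delta>"
    using z(1) by (auto simp: sector_def)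
qed

text \<open>Polar coordinates result from two one-dimensional substitutions: y = x tan \<theta> for
  fixed x, with factor x / cos^2 \<theta>, and, after exchanging the integrals, x = \<rho> cos
  \<theta> for fixed \<theta>, with factor cos \<theta>. Together they give \<rho>.\<close>

lemma nn_integral_sector_symmetric:
  fixes f :: "complex \<Rightarrow> real"
  assumes [measurable]: "f \<in> borel_measurable borel" and nonneg: "\<And>z. 0 \<le> f z"
    and \<delta>: "0 < \<delta>" "\<delta> < pi / 2"
  shows "(\<integral>\<^sup>+z. ennreal (f z) * indicator (sector (- \<delta>) \<delta>) z \<partial>lborel) =
    (\<integral>\<^sup>+\<theta>. (\<integral>\<^sup>+\<rho>. ennreal (f (complex_of_real \<rho> * cis \<theta>) * \<rho>) * indicator {0..} \<rho> \<partial>lborel) *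
       indicator {- \<delta>..\<delta>} \<theta> \<partial>lborel)"
proof -
  let ?S = "sector (- \<delta>) \<delta>"
  have [measurable]: "?S \<in> sets borel"
    unfolding sector_symmetric[OF \<delta>] by measurable
  have [measurable]: "(tan :: real \<Rightarrow> real) \<in> borel_measurable borel"
    unfolding tan_def[abs_def] by measurable
  have "(\<integral>\<^sup>+z. ennreal (f z) * indicator ?S z \<partial>lborel) =
      (\<integral>\<^sup>+x. \<integral>\<^sup>+y. ennreal (f (Complex x y)) * indicator ?S (Complex x y) \<partial>lborel \<partial>lborel)"
    by (rule nn_integral_complex) simp
  also have "\<dots> = (\<integral>\<^sup>+x. \<integral>\<^sup>+\<theta>. ennreal (f (Complex x (x * tan \<theta>)) * x * inverse ((cos \<theta>)\<^sup>2)) *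
      indicator {0<..} x * indicator {- \<delta>..\<delta>} \<theta> \<partial>lborel \<partial>lborel)"
  proof (rule nn_integral_cong)
    fix x :: real
    show "(\<integral>\<^sup>+y. ennreal (f (Complex x y)) * indicator ?S (Complex x y) \<partial>lborel) =
      (\<integral>\<^sup>+\<theta>. ennreal (f (Complex x (x * tan \<theta>)) * x * inverse ((cos \<theta>)\<^sup>2)) *
      indicator {0<..} x * indicator {- \<delta>..\<delta>} \<theta> \<partial>lborel)"
    proof (cases "0 < x")
      case False
      then show ?thesis by (simp add: sector_symmetric[OF \<delta>])
    next
      case True
      have "(\<integral>\<^sup>+y. ennreal (f (Complex x y)) * indicator ?S (Complex x y) \<partial>lborel) =
          ennreal \<bar>x\<bar> * (\<integral>\<^sup>+s. ennreal (f (Complex x (0 + x * s))) * indicator ?S (Complex x (0 + x * s)) \<partial>lborel)"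
        by (rule nn_integral_real_affine) (use True in auto)
      also have "\<dots> = (\<integral>\<^sup>+s. ennreal x * (ennreal (f (Complex x (x * s))) * indicator ?S (Complex x (x * s))) \<partial>lborel)"
        using True by (simp add: nn_integral_cmult)
      also have "\<dots> = (\<integral>\<^sup>+s. ennreal (f (Complex x (x * s)) * x * indicator {tan (- \<delta>)..tan \<delta>} s) \<partial>lborel)"
      \<comment> \<open>The sector omits its upper edge, whereas the substitution rule works on a
        closed interval; the two differ in the single slope tan \<delta>.\<close>
      proof (rule nn_integral_cong_AE, use AE_lborel_singleton[of "tan \<delta>"] in eventually_elim)
        fix s :: real assume "s \<noteq> tan \<delta>"
        then have "Complex x (x * s) \<in> ?S \<longleftrightarrow> s \<in> {tan (- \<delta>)..tan \<delta>}"
          using True by (auto simp: sector_symmetric[OF \<delta>] mult.commute[of x]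
            simp del: mult_minus_left simp flip: tan_minus)
        then show "ennreal x * (ennreal (f (Complex x (x * s))) * indicator ?S (Complex x (x * s))) =
            ennreal (f (Complex x (x * s)) * x * indicator {tan (- \<delta>)..tan \<delta>} s)"
          using True nonneg by (auto simp: indicator_def ennreal_mult' mult.commute)
      qed
      also have "\<dots> = (\<integral>\<^sup>+\<theta>. ennreal (f (Complex x (x * tan \<theta>)) * x * inverse ((cos \<theta>)\<^sup>2) * indicator {- \<delta>..\<delta>} \<theta>) \<partial>lborel)"
      proof (rule nn_integral_substitution)
        show "set_borel_measurable borel {tan (- \<delta>)..tan \<delta>} (\<lambda>s. f (Complex x (x * s)) * x)"
          unfolding set_borel_measurable_def by measurable
        have c: "cos \<theta> \<noteq> 0" if "\<theta> \<in> {- \<delta>..\<delta>}" for \<theta>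
          using that \<delta> cos_gt_zero_pi[of \<theta>] by auto
        show "(tan has_real_derivative inverse ((cos \<theta>)\<^sup>2)) (at \<theta>)" if "\<theta> \<in> {- \<delta>..\<delta>}" for \<theta>
          using DERIV_tan c[OF that] by blast
        show "continuous_on {- \<delta>..\<delta>} (\<lambda>\<theta>. inverse ((cos \<theta>)\<^sup>2))"
          using c by (intro continuous_intros) auto
      qed (use \<delta> in auto)
      finally show ?thesis
        using True by (simp add: ennreal_indicator ennreal_mult'' nonneg)
    qed
  qed
  also have "\<dots> = (\<integral>\<^sup>+\<theta>. \<integral>\<^sup>+x. ennreal (f (Complex x (x * tan \<theta>)) * x * inverse ((cos \<theta>)\<^sup>2)) *
      indicator {0<..} x * indicator {- \<delta>..\<delta>} \<theta> \<partial>lborel \<partial>lborel)"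
    by (rule lborel_pair.Fubini'[symmetric]) (simp add: split_beta')
  also have "\<dots> = (\<integral>\<^sup>+\<theta>. (\<integral>\<^sup>+\<rho>. ennreal (f (complex_of_real \<rho> * cis \<theta>) * \<rho>) * indicator {0..} \<rho> \<partial>lborel) *
       indicator {- \<delta>..\<delta>} \<theta> \<partial>lborel)"
  proof (rule nn_integral_cong)
    fix \<theta> :: real
    let ?g = "\<lambda>x. ennreal (f (Complex x (x * tan \<theta>)) * x * inverse ((cos \<theta>)\<^sup>2)) *
      indicator {0<..} x * indicator {- \<delta>..\<delta>} \<theta>"
    show "(\<integral>\<^sup>+x. ?g x \<partial>lborel) = (\<integral>\<^sup>+\<rho>. ennreal (f (complex_of_real \<rho> * cis \<theta>) * \<rho>) * indicator {0..} \<rho> \<partial>lborel) *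
       indicator {- \<delta>..\<delta>} \<theta>"
    proof (cases "\<theta> \<in> {- \<delta>..\<delta>}")
      case True
      then have c: "0 < cos \<theta>" using \<delta> by (intro cos_gt_zero_pi) auto
      have "(\<integral>\<^sup>+x. ?g x \<partial>lborel) = ennreal \<bar>cos \<theta>\<bar> * (\<integral>\<^sup>+\<rho>. ?g (0 + cos \<theta> * \<rho>) \<partial>lborel)"
        by (rule nn_integral_real_affine) (use c in auto)
      also have "\<dots> = (\<integral>\<^sup>+\<rho>. ennreal \<bar>cos \<theta>\<bar> * ?g (0 + cos \<theta> * \<rho>) \<partial>lborel)"
        by (rule nn_integral_cmult[symmetric]) simp
      also have "\<dots> = (\<integral>\<^sup>+\<rho>. ennreal (f (complex_of_real \<rho> * cis \<theta>) * \<rho>) * indicator {0..} \<rho> \<partial>lborel)"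
      proof (rule nn_integral_cong)
        fix \<rho> :: real
        have "complex_of_real \<rho> * cis \<theta> = Complex (cos \<theta> * \<rho>) (cos \<theta> * \<rho> * tan \<theta>)"
          using c by (simp add: complex_eq_iff tan_def)
        moreover have "ennreal (cos \<theta> * (r * (cos \<theta> * \<rho>) * inverse ((cos \<theta>)\<^sup>2))) = ennreal (r * \<rho>)" for r
          using c by (intro arg_cong[of _ _ ennreal]) (simp add: power2_eq_square field_simps)
        ultimately show "ennreal \<bar>cos \<theta>\<bar> * ?g (0 + cos \<theta> * \<rho>) = ennreal (f (complex_of_real \<rho> * cis \<theta>) * \<rho>) * indicator {0..} \<rho>"
          using c True by (auto simp: indicator_def zero_less_mult_iff ennreal_mult'[symmetric] simp del: mult_cancel_left mult_cancel_right)
      qed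
      finally show ?thesis using True by simp
    qed simp
  qed
  finally show ?thesis .
qed

lemma sector_eq_vimage_symmetric:
  "sector \<alpha> \<beta> = (\<lambda>z. cis (- ((\<alpha> + \<beta>) / 2)) * z) -` sector (- ((\<beta> - \<alpha>) / 2)) ((\<beta> - \<alpha>) / 2)"
proof -
  have "- ((\<beta> - \<alpha>) / 2) - (- ((\<alpha> + \<beta>) / 2)) = \<alpha>" "(\<beta> - \<alpha>) / 2 - (- ((\<alpha> + \<beta>) / 2)) = \<beta>"
    by (simp_all add: field_simps)
  then show ?thesis by (simp only: vimage_def sector_rotate Collect_mem_eq)
qed

lemma sets_sector_narrow:
  assumes "\<alpha> < \<beta>" "\<beta> - \<alpha> < pi"
  shows "sector \<alpha> \<beta> \<in> sets borel"
proof -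
  have *: "sector (- ((\<beta> - \<alpha>) / 2)) ((\<beta> - \<alpha>) / 2) \<in> sets borel"
    by (subst sector_symmetric) (use assms in auto)
  have "(\<lambda>z. cis (- ((\<alpha> + \<beta>) / 2)) * z) \<in> borel_measurable borel" by simp
  from measurable_sets[OF this *] show ?thesis
    by (subst sector_eq_vimage_symmetric) simp
qed

text \<open>Rotation by the angle \<tau> of the bisector reduces the claim to the symmetric case; it
  preserves the measure because \<open>cis \<tau>\<close> has modulus 1.\<close>

lemma nn_integral_sector_narrow:
  fixes f :: "complex \<Rightarrow> real"
  assumes [measurable]: "f \<in> borel_measurable borel" and nonneg: "\<And>z. 0 \<le> f z"
    and \<alpha>\<beta>: "\<alpha> < \<beta>" "\<beta> - \<alpha> < pi"
  shows "(\<integral>\<^sup>+z. ennreal (f z) * indicator (sector \<alpha> \<beta>) z \<partial>lborel) =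
    (\<integral>\<^sup>+\<theta>. (\<integral>\<^sup>+\<rho>. ennreal (f (complex_of_real \<rho> * cis \<theta>) * \<rho>) * indicator {0..} \<rho> \<partial>lborel) *
       indicator {\<alpha>..\<beta>} \<theta> \<partial>lborel)"
proof -
  define \<tau> \<delta> where "\<tau> = (\<alpha> + \<beta>) / 2" and "\<delta> = (\<beta> - \<alpha>) / 2"
  have \<delta>: "0 < \<delta>" "\<delta> < pi / 2" and \<alpha>: "\<alpha> = \<tau> - \<delta>" and \<beta>: "\<beta> = \<tau> + \<delta>"
    using \<alpha>\<beta> by (simp_all add: \<delta>_def \<tau>_def field_simps)
  note [measurable] = sets_sector_narrow[OF \<alpha>\<beta>]
  let ?h = "\<lambda>\<theta>. \<integral>\<^sup>+\<rho>. ennreal (f (complex_of_real \<rho> * cis \<theta>) * \<rho>) * indicator {0..} \<rho> \<partial>lborel"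
  have [measurable]: "cis \<in> borel_measurable borel"
    by (intro borel_measurable_continuous_onI continuous_intros)
  have [measurable]: "?h \<in> borel_measurable borel"
    by measurable
  have "(\<integral>\<^sup>+z. ennreal (f z) * indicator (sector \<alpha> \<beta>) z \<partial>lborel) =
      ennreal ((cmod (cis \<tau>))\<^sup>2) * (\<integral>\<^sup>+z. ennreal (f (cis \<tau> * z)) * indicator (sector \<alpha> \<beta>) (cis \<tau> * z) \<partial>lborel)"
    by (rule nn_integral_complex_mult) simp_all
  also have "\<dots> = (\<integral>\<^sup>+z. ennreal (f (cis \<tau> * z)) * indicator (sector (- \<delta>) \<delta>) z \<partial>lborel)"
    by (simp add: indicator_def sector_rotate \<alpha> \<beta>)
  also have "\<dots> = (\<integral>\<^sup>+\<theta>. ?h (\<tau> + 1 * \<theta>) * indicator {\<alpha>..\<beta>} (\<tau> + 1 * \<theta>) \<partial>lborel)"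
    by (subst nn_integral_sector_symmetric[OF _ _ \<delta>])
      (auto intro!: nn_integral_cong simp: nonneg mult.left_commute[of "cis \<tau>"] cis_mult indicator_def \<alpha> \<beta>)
  also have "\<dots> = (\<integral>\<^sup>+\<theta>. ?h \<theta> * indicator {\<alpha>..\<beta>} \<theta> \<partial>lborel)"
    by (subst nn_integral_real_affine[of "\<lambda>\<theta>. ?h \<theta> * indicator {\<alpha>..\<beta>} \<theta>" 1 \<tau>]) simp_all
  finally show ?thesis .
qed

lemma sector_split:
  assumes "\<alpha> \<le> \<mu>" "\<mu> \<le> \<beta>"
  shows "sector \<alpha> \<beta> = sector \<alpha> \<mu> \<union> sector \<mu> \<beta>"
proof -
  have "\<alpha> \<le> \<theta> \<and> \<theta> < \<beta> \<longleftrightarrow> \<alpha> \<le> \<theta> \<and> \<theta> < \<mu> \<or> \<mu> \<le> \<theta> \<and> \<theta> < \<beta>" for \<theta>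
    using assms by linarith
  then show ?thesis unfolding sector_def by blast
qed

text \<open>Two representatives of the phase of a common point would differ by an integer multiple
  of 2 pi lying strictly between 0 and 2 pi.\<close>

lemma sector_disjoint:
  assumes "\<beta> - \<alpha> < 2 * pi"
  shows "sector \<alpha> \<mu> \<inter> sector \<mu> \<beta> = {}"
proof (rule ccontr)
  assume "sector \<alpha> \<mu> \<inter> sector \<mu> \<beta> \<noteq> {}"
  then obtain z \<theta> \<eta> where z: "z \<noteq> 0" "z = complex_of_real (cmod z) * cis \<theta>" "z = complex_of_real (cmod z) * cis \<eta>"
    and *: "\<alpha> \<le> \<theta>" "\<theta> < \<mu>" "\<mu> \<le> \<eta>" "\<eta> < \<beta>"
    unfolding sector_def by blast
  have "complex_of_real (cmod z) * cis \<theta> = complex_of_real (cmod z) * cis \<eta>"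
    using z by metis
  then have "cis \<theta> = cis \<eta>" using z(1) by simp
  then have "cis (\<eta> - \<theta>) = 1" by (simp flip: cis_divide)
  then have "cos (\<eta> - \<theta>) = 1" by (simp add: complex_eq_iff)
  then obtain n :: int where n: "\<eta> - \<theta> = real_of_int n * 2 * pi" unfolding cos_one_2pi_int by blast
  have "0 < real_of_int n * 2 * pi" "real_of_int n * 2 * pi < 1 * 2 * pi" using * assms n by linarith+
  then have "0 < n" "n < 1" by (simp_all add: zero_less_mult_iff)
  then show False by simp
qed

lemma sets_sector [measurable]:
  assumes "\<alpha> < \<beta>" "\<beta> - \<alpha> < 2 * pi"
  shows "sector \<alpha> \<beta> \<in> sets borel"
proof -
  have "sector \<alpha> ((\<alpha> + \<beta>) / 2) \<in> sets borel" "sector ((\<alpha> + \<beta>) / 2) \<beta> \<in> sets borel"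
    using assms by (auto intro!: sets_sector_narrow simp: field_simps)
  then show ?thesis
    using assms by (subst sector_split[of \<alpha> "(\<alpha> + \<beta>) / 2"]) auto
qed

text \<open>Halving at the midpoint brings both pieces below the opening pi, beyond which the
  tangent is no longer a coordinate. For M = 2 the decision regions are half planes, of opening
  exactly pi.\<close>

lemma nn_integral_sector:
  fixes f :: "complex \<Rightarrow> real"
  assumes [measurable]: "f \<in> borel_measurable borel" and nonneg: "\<And>z. 0 \<le> f z"
    and \<alpha>\<beta>: "\<alpha> < \<beta>" "\<beta> - \<alpha> < 2 * pi"
  shows "(\<integral>\<^sup>+z. ennreal (f z) * indicator (sector \<alpha> \<beta>) z \<partial>lborel) =
      (\<integral>\<^sup>+\<theta>. (\<integral>\<^sup>+\<rho>. ennreal (f (complex_of_real \<rho> * cis \<theta>) * \<rho>) * indicator {0..} \<rho> \<partial>lborel) *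
         indicator {\<alpha>..\<beta>} \<theta> \<partial>lborel)"
proof -
  define \<mu> where "\<mu> = (\<alpha> + \<beta>) / 2"
  have 1: "\<alpha> < \<mu>" "\<mu> - \<alpha> < pi" and 2: "\<mu> < \<beta>" "\<beta> - \<mu> < pi"
    using \<alpha>\<beta> by (simp_all add: \<mu>_def field_simps)
  note split = sector_split[of \<alpha> \<mu> \<beta>] and disj = sector_disjoint[OF \<alpha>\<beta>(2), of \<mu>]
  note [measurable] = sets_sector_narrow[OF 1] sets_sector_narrow[OF 2]
  let ?h = "\<lambda>\<theta>. \<integral>\<^sup>+\<rho>. ennreal (f (complex_of_real \<rho> * cis \<theta>) * \<rho>) * indicator {0..} \<rho> \<partial>lborel"
  have [measurable]: "cis \<in> borel_measurable borel"
    by (intro borel_measurable_continuous_onI continuous_intros)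
  have [measurable]: "?h \<in> borel_measurable borel"
    by measurable
  have "(\<integral>\<^sup>+z. ennreal (f z) * indicator (sector \<alpha> \<beta>) z \<partial>lborel) =
      (\<integral>\<^sup>+z. ennreal (f z) * indicator (sector \<alpha> \<mu>) z + ennreal (f z) * indicator (sector \<mu> \<beta>) z \<partial>lborel)"
    using 1 2 disj by (intro nn_integral_cong) (auto simp: split indicator_def)
  also have "\<dots> = (\<integral>\<^sup>+z. ennreal (f z) * indicator (sector \<alpha> \<mu>) z \<partial>lborel) +
      (\<integral>\<^sup>+z. ennreal (f z) * indicator (sector \<mu> \<beta>) z \<partial>lborel)"
    by (rule nn_integral_add) simp_all
  also have "\<dots> = (\<integral>\<^sup>+\<theta>. ?h \<theta> * indicator {\<alpha>..\<mu>} \<theta> \<partial>lborel) + (\<integral>\<^sup>+\<theta>. ?h \<theta> * indicator {\<mu>..\<beta>} \<theta> \<partial>lborel)"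
    by (simp only: nn_integral_sector_narrow[OF assms(1,2) 1] nn_integral_sector_narrow[OF assms(1,2) 2])
  also have "\<dots> = (\<integral>\<^sup>+\<theta>. ?h \<theta> * indicator {\<alpha>..\<mu>} \<theta> + ?h \<theta> * indicator {\<mu>..\<beta>} \<theta> \<partial>lborel)"
    by (rule nn_integral_add[symmetric]) simp_all
  also have "\<dots> = (\<integral>\<^sup>+\<theta>. ?h \<theta> * indicator {\<alpha>..\<beta>} \<theta> \<partial>lborel)"
    by (rule nn_integral_cong_AE, use AE_lborel_singleton[of \<mu>] in eventually_elim)
      (use 1 2 in \<open>auto simp: indicator_def\<close>)
  finally show "(\<integral>\<^sup>+z. ennreal (f z) * indicator (sector \<alpha> \<beta>) z \<partial>lborel) = \<dots>" .
qed

section \<open>Gaussian mass of a sector\<close>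

definition gauss_primitive :: "real \<Rightarrow> real" where
  "gauss_primitive x = (LBINT y=0..ereal x. exp (- y\<^sup>2))"

lemma gauss_primitive_0 [simp]: "gauss_primitive 0 = 0"
  unfolding gauss_primitive_def by (simp add: zero_ereal_def)

lemma DERIV_gauss_primitive: "(gauss_primitive has_real_derivative exp (- x\<^sup>2)) (at x)"
proof -
  let ?b = "\<bar>x\<bar> + 1"
  have "((\<lambda>u. LBINT y=ereal 0..ereal u. exp (- y\<^sup>2)) has_vector_derivative exp (- x\<^sup>2)) (at x within {- ?b..?b})"
    by (rule interval_integral_FTC2) (auto intro!: continuous_intros)
  moreover have "at x within {- ?b..?b} = at x"
    by (rule at_within_interior) (auto simp: interior_atLeastAtMost_real)
  ultimately show ?thesis
    by (simp add: gauss_primitive_def[abs_def] has_real_derivative_iff_has_vector_derivative zero_ereal_def)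
qed

lemmas DERIV_gauss_primitive' [derivative_intros] = DERIV_chain2[OF DERIV_gauss_primitive]

lemma continuous_on_gauss_primitive [continuous_intros]:
  "continuous_on S f \<Longrightarrow> continuous_on S (\<lambda>x. gauss_primitive (f x))"
  by (rule continuous_on_compose2[of UNIV gauss_primitive])
    (auto intro!: DERIV_continuous_on DERIV_gauss_primitive)

lemma gauss_primitive_minus: "gauss_primitive (- x) = - gauss_primitive x"
proof -
  have "((\<lambda>x. gauss_primitive (- x) + gauss_primitive x) has_real_derivative 0) (at x)" for x
    by (auto intro!: derivative_eq_intros)
  then have "gauss_primitive (- x) + gauss_primitive x = gauss_primitive (- 0) + gauss_primitive 0"
    using DERIV_isconst_all by blast
  then show ?thesis by simp
qed

lemma tendsto_gauss_primitive: "(gauss_primitive \<longlongrightarrow> sqrt pi / 2) at_top"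
proof -
  let ?f = "\<lambda>x :: real. indicator {0..} x *\<^sub>R exp (- x\<^sup>2)"
  have "((\<lambda>y. \<integral>x. indicator {..y} x *\<^sub>R ?f x \<partial>lborel) \<longlongrightarrow> (\<integral>x. ?f x \<partial>lborel)) at_top"
    by (rule tendsto_integral_at_top) (use gaussian_moment_0 in \<open>auto simp: has_bochner_integral_iff\<close>)
  also have "(\<integral>x. ?f x \<partial>lborel) = sqrt pi / 2"
    using gaussian_moment_0 by (simp add: has_bochner_integral_iff)
  finally show ?thesis
  proof (rule Lim_transform_eventually)
    show "\<forall>\<^sub>F y in at_top. (\<integral>x. indicator {..y} x *\<^sub>R ?f x \<partial>lborel) = gauss_primitive y"
      using eventually_ge_at_top[of 0]
    proof eventually_elim
      fix y :: real assume "0 \<le> y"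
      then have "(\<integral>x. exp (- x\<^sup>2) * indicator {0..y} x \<partial>lborel) = gauss_primitive y - gauss_primitive 0"
        by (intro integral_FTC_Icc_real) (auto intro!: DERIV_gauss_primitive continuous_intros)
      moreover have "indicator {..y} x *\<^sub>R ?f x = exp (- x\<^sup>2) * indicator {0..y} x" for x
        by (auto simp: indicator_def)
      ultimately show "(\<integral>x. indicator {..y} x *\<^sub>R ?f x \<partial>lborel) = gauss_primitive y"
        by (simp only: gauss_primitive_0 diff_zero)
    qed
  qed
qed

text \<open>Up to the factor \<open>1 / \<pi>\<close>, the density of the phase of \<open>a + w\<close>, where \<open>w\<close> has density
  \<open>exp (- \<bar>w\<bar>\<^sup>2) / \<pi>\<close>.\<close>

definition phase_density :: "real \<Rightarrow> real \<Rightarrow> real" where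
  "phase_density a \<theta> = exp (- (a * sin \<theta>)\<^sup>2) *
     (exp (- (a * cos \<theta>)\<^sup>2) / 2 + a * cos \<theta> * (sqrt pi / 2 + gauss_primitive (a * cos \<theta>)))"

text \<open>Chosen so that its derivative with respect to \<open>\<theta>\<close> is the derivative of the phase density
  with respect to \<open>a\<close>.\<close>

definition phase_flux :: "real \<Rightarrow> real \<Rightarrow> real" where
  "phase_flux a \<theta> = sin \<theta> * exp (- (a * sin \<theta>)\<^sup>2) * (sqrt pi / 2 + gauss_primitive (a * cos \<theta>))"

lemma continuous_on_phase_density: "continuous_on S (phase_density a)"
  unfolding phase_density_def[abs_def] by (intro continuous_intros) auto

text \<open>With b = a cos \<theta>, the squared distance from a to the point of radius \<rho>
  splits into (a sin \<theta>)^2 + (\<rho> - b)^2, and \<rho> exp (-(\<rho> - b)^2) has the explicit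
  primitive in \<open>F\<close>. Positivity is proved alongside: for cos \<theta> < 0 it is not
  visible in the formula, but the density is, up to 1 / pi, the total increase
  \<open>T - F 0\<close> of that primitive.\<close>

lemma
  shows nn_integral_radial:
      "(\<integral>\<^sup>+\<rho>. ennreal (exp (- (cmod (complex_of_real \<rho> * cis \<theta> - complex_of_real a))\<^sup>2) / pi * \<rho>) *
         indicator {0..} \<rho> \<partial>lborel) = ennreal (phase_density a \<theta> / pi)"
    and phase_density_pos: "0 < phase_density a \<theta>"
proof -
  define b where "b = a * cos \<theta>"
  define F where "F \<rho> = exp (- (a * sin \<theta>)\<^sup>2) / pi * (b * gauss_primitive (\<rho> - b) - exp (- (\<rho> - b)\<^sup>2) / 2)" for \<rho>
  define T where "T = exp (- (a * sin \<theta>)\<^sup>2) / pi * (b * (sqrt pi / 2) - 0 / 2)"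
  let ?f = "\<lambda>\<rho>. exp (- (cmod (complex_of_real \<rho> * cis \<theta> - complex_of_real a))\<^sup>2) / pi * \<rho>"
  have "(cmod (complex_of_real \<rho> * cis \<theta> - complex_of_real a))\<^sup>2 = (a * sin \<theta>)\<^sup>2 + (\<rho> - b)\<^sup>2" for \<rho>
  proof -
    have "(cmod (complex_of_real \<rho> * cis \<theta> - complex_of_real a))\<^sup>2 = (\<rho> * cos \<theta> - a)\<^sup>2 + (\<rho> * sin \<theta>)\<^sup>2"
      by (simp add: cmod_power2)
    also have "\<dots> = (\<rho>\<^sup>2 + a\<^sup>2) * ((sin \<theta>)\<^sup>2 + (cos \<theta>)\<^sup>2) - 2 * a * \<rho> * cos \<theta>"
      unfolding sin_cos_squared_add using sin_cos_squared_add[of \<theta>] by algebra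
    also have "\<dots> = (a * sin \<theta>)\<^sup>2 + (\<rho> - b)\<^sup>2"
      unfolding b_def using sin_cos_squared_add[of \<theta>] by algebra
    finally show ?thesis .
  qed
  then have f: "?f \<rho> = exp (- (a * sin \<theta>)\<^sup>2) / pi * (exp (- (\<rho> - b)\<^sup>2) * \<rho>)" for \<rho>
    by (simp add: exp_add[symmetric])
  have F': "(F has_real_derivative ?f \<rho>) (at \<rho>)" for \<rho>
    unfolding f F_def by (rule derivative_eq_intros refl | simp add: field_simps)+
  have lim: "(F \<longlongrightarrow> T) at_top"
  proof -
    have *: "filterlim (\<lambda>\<rho>. \<rho> - b) at_top at_top"
      using filterlim_tendsto_add_at_top[OF tendsto_const[of "- b"] filterlim_ident] by simp
    then have "((\<lambda>\<rho>. exp (- (\<rho> - b)\<^sup>2)) \<longlongrightarrow> 0) at_top"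
      by (intro filterlim_compose[OF exp_at_bot] filterlim_compose[OF filterlim_uminus_at_bot_at_top]
        filterlim_pow_at_top) auto
    then show ?thesis
      unfolding F_def T_def using pi_neq_zero
      by (intro tendsto_intros filterlim_compose[OF tendsto_gauss_primitive *]) auto
  qed
  have TF: "T - F 0 = phase_density a \<theta> / pi"
    by (simp add: T_def F_def phase_density_def b_def gauss_primitive_minus field_simps)
  have "(\<integral>\<^sup>+\<rho>. ennreal (?f \<rho>) * indicator {0..} \<rho> \<partial>lborel) = ennreal (T - F 0)"
    by (rule nn_integral_FTC_atLeast[where f = "?f"]) (use F' lim in auto)
  then show "(\<integral>\<^sup>+\<rho>. ennreal (?f \<rho>) * indicator {0..} \<rho> \<partial>lborel) = ennreal (phase_density a \<theta> / pi)"
    by (simp only: TF)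
  have cont: "continuous_on S F" for S
    by (intro continuous_at_imp_continuous_on ballI DERIV_isCont[OF F'])
  \<comment> \<open>An intermediate point keeps the inequality strict, which the passage to the
    limit alone would lose. The integrand vanishes at 0, so its positivity is used on the open
    interval only.\<close>
  have "F 0 < F 1"
    by (rule DERIV_pos_imp_increasing_open[OF zero_less_one _ cont], intro exI conjI, rule F') simp
  also have "F 1 \<le> T"
  proof (rule tendsto_lowerbound[OF lim])
    show "\<forall>\<^sub>F \<rho> in at_top. F 1 \<le> F \<rho>"
      using eventually_ge_at_top[of 1]
      by eventually_elim (rule DERIV_nonneg_imp_nondecreasing, assumption, intro exI conjI, rule F', simp)
  qed simp
  finally have "0 < phase_density a \<theta> / pi"
    using TF by linarith
  then show "0 < phase_density a \<theta>"
    by (simp add: zero_less_divide_iff)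
qed

section \<open>Sector probabilities and their derivative in the amplitude\<close>

definition sector_prob :: "real \<Rightarrow> real \<Rightarrow> real \<Rightarrow> real" where
  "sector_prob \<alpha> \<beta> a = integral {\<alpha>..\<beta>} (phase_density a) / pi"

lemma sector_prob_0: "\<alpha> \<le> \<beta> \<Longrightarrow> sector_prob \<alpha> \<beta> 0 = (\<beta> - \<alpha>) / (2 * pi)"
  by (simp add: sector_prob_def phase_density_def[abs_def])

lemma sector_prob_pos:
  assumes "\<alpha> < \<beta>"
  shows "0 < sector_prob \<alpha> \<beta> a"
proof -
  have "integral {\<alpha>..\<beta>} (phase_density a) = 0 \<longleftrightarrow> (\<forall>\<theta>\<in>{\<alpha>..\<beta>}. phase_density a \<theta> = 0)"
    using assms by (intro integral_eq_0_iff continuous_on_phase_density) (simp_all add: phase_density_pos less_imp_le)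
  then have "integral {\<alpha>..\<beta>} (phase_density a) \<noteq> 0"
    using phase_density_pos[of a \<alpha>] assms by force
  moreover have "0 \<le> integral {\<alpha>..\<beta>} (phase_density a)"
    by (intro integral_nonneg integrable_continuous_real continuous_on_phase_density)
      (simp add: phase_density_pos less_imp_le)
  ultimately show ?thesis by (simp add: sector_prob_def)
qed

lemma DERIV_sector_prob:
  assumes "\<alpha> \<le> \<beta>"
  shows "(sector_prob \<alpha> \<beta> has_real_derivative (phase_flux a \<beta> - phase_flux a \<alpha>) / pi) (at a)"
proof -
  \<comment> \<open>The common value of the amplitude derivative of the density and the phase
    derivative of the flux, written with the two exponentials collapsed to exp (-a^2) and with cos^2
    \<theta> eliminated where it stands beside that factor.\<close>
  define D where "D a \<theta> = exp (- (a * sin \<theta>)\<^sup>2) * (cos \<theta> - 2 * a\<^sup>2 * (sin \<theta>)\<^sup>2 * cos \<theta>) *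
     (sqrt pi / 2 + gauss_primitive (a * cos \<theta>)) - a * (sin \<theta>)\<^sup>2 * exp (- a\<^sup>2)" for a \<theta> :: real
  have e: "exp (- (a * sin \<theta>)\<^sup>2) * exp (- (a * cos \<theta>)\<^sup>2) = exp (- a\<^sup>2)" for a \<theta> :: real
  proof -
    have "a\<^sup>2 = (a * sin \<theta>)\<^sup>2 + (a * cos \<theta>)\<^sup>2"
      using sin_cos_squared_add[of \<theta>] by algebra
    then show ?thesis by (simp add: exp_add[symmetric])
  qed
  have pd: "phase_density a \<theta> = exp (- a\<^sup>2) / 2 +
      exp (- (a * sin \<theta>)\<^sup>2) * (a * cos \<theta> * (sqrt pi / 2 + gauss_primitive (a * cos \<theta>)))" for a \<theta> :: real
    by (simp add: phase_density_def distrib_left e)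
  have D1: "((\<lambda>a. phase_density a \<theta>) has_real_derivative D a \<theta>) (at a)" for a \<theta>
  proof -
    have "((\<lambda>a. phase_density a \<theta>) has_real_derivative
      - a * exp (- a\<^sup>2) + exp (- (a * sin \<theta>)\<^sup>2) * (- 2 * a * (sin \<theta>)\<^sup>2) * (a * cos \<theta> * (sqrt pi / 2 + gauss_primitive (a * cos \<theta>)))
       + exp (- (a * sin \<theta>)\<^sup>2) * (cos \<theta> * (sqrt pi / 2 + gauss_primitive (a * cos \<theta>)))
       + a * (cos \<theta>)\<^sup>2 * (exp (- (a * sin \<theta>)\<^sup>2) * exp (- (a * cos \<theta>)\<^sup>2))) (at a)"
      unfolding pd by (auto intro!: derivative_eq_intros simp: field_simps power2_eq_square)
    also have "- a * exp (- a\<^sup>2) + exp (- (a * sin \<theta>)\<^sup>2) * (- 2 * a * (sin \<theta>)\<^sup>2) * (a * cos \<theta> * (sqrt pi / 2 + gauss_primitive (a * cos \<theta>)))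
       + exp (- (a * sin \<theta>)\<^sup>2) * (cos \<theta> * (sqrt pi / 2 + gauss_primitive (a * cos \<theta>)))
       + a * (cos \<theta>)\<^sup>2 * (exp (- (a * sin \<theta>)\<^sup>2) * exp (- (a * cos \<theta>)\<^sup>2)) = D a \<theta>"
      unfolding e D_def cos_squared_eq by algebra
    finally show ?thesis .
  qed
  have D2: "((\<lambda>\<theta>. phase_flux a \<theta>) has_real_derivative D a \<theta>) (at \<theta>)" for \<theta>
  proof -
    have "((\<lambda>\<theta>. phase_flux a \<theta>) has_real_derivative
      cos \<theta> * exp (- (a * sin \<theta>)\<^sup>2) * (sqrt pi / 2 + gauss_primitive (a * cos \<theta>))
      + sin \<theta> * (exp (- (a * sin \<theta>)\<^sup>2) * (- 2 * a\<^sup>2 * sin \<theta> * cos \<theta>)) * (sqrt pi / 2 + gauss_primitive (a * cos \<theta>))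
      - a * (sin \<theta>)\<^sup>2 * (exp (- (a * sin \<theta>)\<^sup>2) * exp (- (a * cos \<theta>)\<^sup>2))) (at \<theta>)"
      unfolding phase_flux_def by (auto intro!: derivative_eq_intros simp: field_simps power2_eq_square)
    also have "cos \<theta> * exp (- (a * sin \<theta>)\<^sup>2) * (sqrt pi / 2 + gauss_primitive (a * cos \<theta>))
      + sin \<theta> * (exp (- (a * sin \<theta>)\<^sup>2) * (- 2 * a\<^sup>2 * sin \<theta> * cos \<theta>)) * (sqrt pi / 2 + gauss_primitive (a * cos \<theta>))
      - a * (sin \<theta>)\<^sup>2 * (exp (- (a * sin \<theta>)\<^sup>2) * exp (- (a * cos \<theta>)\<^sup>2)) = D a \<theta>"
      unfolding e D_def by algebra
    finally show ?thesis .
  qed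
  have "((\<lambda>a. integral (cbox \<alpha> \<beta>) (phase_density a)) has_field_derivative integral (cbox \<alpha> \<beta>) (D a)) (at a within UNIV)"
  proof (rule leibniz_rule_field_derivative)
    show "continuous_on (UNIV \<times> cbox \<alpha> \<beta>) (\<lambda>(a, \<theta>). D a \<theta>)"
      unfolding D_def split_beta' by (intro continuous_intros) auto
  qed (use D1 in \<open>auto intro!: integrable_continuous_real continuous_on_phase_density\<close>)
  moreover have "(D a has_integral (phase_flux a \<beta> - phase_flux a \<alpha>)) {\<alpha>..\<beta>}"
    by (rule fundamental_theorem_of_calculus[OF assms])
      (simp flip: has_real_derivative_iff_has_vector_derivative add: has_field_derivative_at_within[OF D2])
  ultimately have "((\<lambda>a. integral {\<alpha>..\<beta>} (phase_density a)) has_real_derivative phase_flux a \<beta> - phase_flux a \<alpha>) (at a)"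
    by (simp add: integral_unique)
  then show ?thesis
    unfolding sector_prob_def[abs_def] by (rule DERIV_cdivide)
qed

lemma nn_integral_gauss_sector:
  assumes "\<alpha> < \<beta>" "\<beta> - \<alpha> < 2 * pi"
  shows "(\<integral>\<^sup>+z. ennreal (exp (- (cmod (z - complex_of_real a))\<^sup>2) / pi) * indicator (sector \<alpha> \<beta>) z \<partial>lborel) =
    ennreal (sector_prob \<alpha> \<beta> a)"
proof -
  have "(\<integral>\<^sup>+z. ennreal (exp (- (cmod (z - complex_of_real a))\<^sup>2) / pi) * indicator (sector \<alpha> \<beta>) z \<partial>lborel) =
      (\<integral>\<^sup>+\<theta>. ennreal (phase_density a \<theta> / pi) * indicator {\<alpha>..\<beta>} \<theta> \<partial>lborel)"
    by (subst nn_integral_sector[OF _ _ assms]) (simp_all only: nn_integral_radial, simp_all)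
  also have "\<dots> = integral {\<alpha>..\<beta>} (\<lambda>\<theta>. phase_density a \<theta> / pi)"
  proof (rule nn_integral_has_integral_lebesgue')
    show "((\<lambda>\<theta>. phase_density a \<theta> / pi) has_integral integral {\<alpha>..\<beta>} (\<lambda>\<theta>. phase_density a \<theta> / pi)) {\<alpha>..\<beta>}"
      by (intro integrable_integral integrable_continuous_real continuous_intros continuous_on_phase_density) auto
  qed (simp add: phase_density_pos less_imp_le)
  finally show ?thesis by (simp add: sector_prob_def)
qed

section \<open>Transition probabilities\<close>

lemma sector_scale:
  assumes "0 < t"
  shows "complex_of_real t * z \<in> sector \<alpha> \<beta> \<longleftrightarrow> z \<in> sector \<alpha> \<beta>"
proof -
  have "complex_of_real t * z = complex_of_real (cmod (complex_of_real t * z)) * cis \<theta> \<longleftrightarrow>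
      z = complex_of_real (cmod z) * cis \<theta>" for \<theta>
    using assms by (simp add: norm_mult mult.assoc)
  then show ?thesis using assms by (simp add: sector_def)
qed

lemma decision_region_eq_sector:
  assumes "0 < M"
  shows "decision_region M d l =
    insert 0 (sector (Arg d + (2 * real l - 1) * pi / real M) (Arg d + (2 * real l + 1) * pi / real M))"
    (is "_ = insert 0 (sector (_ + ?\<alpha>) (_ + ?\<beta>))")
proof (rule set_eqI)
  fix r :: complex
  have less: "?\<alpha> < ?\<beta>"
    using assms by (intro divide_strict_right_mono mult_strict_right_mono) auto
  show "r \<in> decision_region M d l \<longleftrightarrow> r \<in> insert 0 (sector (Arg d + ?\<alpha>) (Arg d + ?\<beta>))"
  proof (cases "r = 0")
    case True
    then show ?thesis using less by (auto simp: decision_region_def)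
  next
    case False
    let ?Q = "\<lambda>\<theta>. r = complex_of_real (cmod r) * cis \<theta>"
    have "(\<exists>\<theta>. ?\<alpha> \<le> \<theta> \<and> \<theta> < ?\<beta> \<and> ?Q (Arg d + \<theta>)) \<longleftrightarrow> (\<exists>\<theta>. Arg d + ?\<alpha> \<le> \<theta> \<and> \<theta> < Arg d + ?\<beta> \<and> ?Q \<theta>)"
      (is "?L = ?R")
    proof
      assume ?L
      then obtain \<theta> where "?\<alpha> \<le> \<theta>" "\<theta> < ?\<beta>" "?Q (Arg d + \<theta>)" by blast
      then show ?R by (intro exI[of _ "Arg d + \<theta>"]) auto
    next
      assume ?R
      then obtain \<theta> where "Arg d + ?\<alpha> \<le> \<theta>" "\<theta> < Arg d + ?\<beta>" "?Q (Arg d + (\<theta> - Arg d))" by auto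
      then show ?L by (intro exI[of _ "\<theta> - Arg d"]) (auto simp del: add_diff_cancel_left' add_diff_cancel diff_add_cancel)
    qed
    then show ?thesis using False by (simp add: decision_region_def sector_def)
  qed
qed

text \<open>The substitution r = c z with c = sqrt v \<open>cis (Arg d)\<close> removes the phase of
  d and the total variance v at once: the mean d s becomes the nonnegative real a, the Jacobian v
  cancels the normalisation of the density, and the decision region becomes a sector that no longer
  depends on d.\<close>

lemma psk_trans_prob_eq_sector_prob:
  assumes M: "2 \<le> M" and N0: "0 < N0" and snr: "0 \<le> snr"
  shows "psk_trans_prob M d \<gamma> (snr * N0) N0 l 0 =
    sector_prob ((2 * real l - 1) * pi / real M) ((2 * real l + 1) * pi / real M)
      (cmod d * sqrt (snr / (\<gamma>\<^sup>2 * snr + 1)))"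
proof -
  define \<alpha> \<beta> where "\<alpha> = (2 * real l - 1) * pi / real M" and "\<beta> = (2 * real l + 1) * pi / real M"
  define \<phi> where "\<phi> = Arg d"
  have width: "\<beta> - \<alpha> = 2 * pi / real M"
    by (simp add: \<alpha>_def \<beta>_def diff_divide_distrib[symmetric] algebra_simps)
  have \<alpha>\<beta>: "\<alpha> < \<beta>" "\<beta> - \<alpha> < 2 * pi"
  proof -
    have "0 < 2 * pi / real M" "2 * pi / real M < 2 * pi"
      using M by (simp_all add: field_simps)
    then show "\<alpha> < \<beta>" "\<beta> - \<alpha> < 2 * pi"
      unfolding width[symmetric] by simp_all
  qed
  define w where "w = \<gamma>\<^sup>2 * snr + 1"
  define v where "v = N0 * w"
  define a where "a = cmod d * sqrt (snr / w)"
  have w: "0 < w" using snr by (simp add: w_def add_nonneg_pos)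
  then have v: "0 < v" using N0 by (simp add: v_def)
  define s where "s = psk_signal M (snr * N0) 0"
  have s: "s = complex_of_real (sqrt (snr * N0))"
    by (simp add: s_def psk_signal_def)
  have cs: "\<gamma>\<^sup>2 * (cmod s)\<^sup>2 + N0 = v"
    using N0 snr by (simp add: s v_def w_def algebra_simps)
  let ?f = "rician_density d \<gamma> N0 s"
  have [measurable]: "?f \<in> borel_measurable borel"
    unfolding rician_density_def[abs_def] cs by (intro borel_measurable_continuous_onI continuous_intros) (use v in auto)
  have \<alpha>\<beta>': "\<phi> + \<alpha> < \<phi> + \<beta>" "\<phi> + \<beta> - (\<phi> + \<alpha>) < 2 * pi"
    using \<alpha>\<beta> by simp_all
  note [measurable] = sets_sector[OF \<alpha>\<beta>'] sets_sector[OF \<alpha>\<beta>]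
  define c where "c = complex_of_real (sqrt v) * cis \<phi>"
  have c: "c \<noteq> 0" "(cmod c)\<^sup>2 = v" using v by (simp_all add: c_def norm_mult)
  have region: "decision_region M d l = insert 0 (sector (\<phi> + \<alpha>) (\<phi> + \<beta>))"
    using M by (simp add: decision_region_eq_sector \<alpha>_def \<beta>_def \<phi>_def)
  have density: "v * ?f (c * z) = exp (- (cmod (z - complex_of_real a))\<^sup>2) / pi" for z
  proof -
    have "d * s = c * complex_of_real a"
    proof -
      have "sqrt v * sqrt (snr / w) = sqrt (snr * N0)"
        using w N0 by (simp add: v_def real_sqrt_mult[symmetric])
      then have "c * complex_of_real a = complex_of_real (cmod d) * cis \<phi> * complex_of_real (sqrt (snr * N0))"
        by (simp add: c_def a_def mult_ac flip: of_real_mult)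
      then show ?thesis
        by (simp add: s \<phi>_def flip: rcis_def add: rcis_cmod_Arg)
    qed
    then have "(cmod (c * z - d * s))\<^sup>2 = v * (cmod (z - complex_of_real a))\<^sup>2"
      by (simp only: right_diff_distrib[symmetric] norm_mult power_mult_distrib c(2))
    then show ?thesis
      using v by (simp add: rician_density_def cs)
  qed
  have "emeasure (density lborel (\<lambda>r. ennreal (?f r))) (decision_region M d l) =
      (\<integral>\<^sup>+r. ennreal (?f r) * indicator (insert 0 (sector (\<phi> + \<alpha>) (\<phi> + \<beta>))) r \<partial>lborel)"
    unfolding region by (subst emeasure_density) auto
  also have "\<dots> = (\<integral>\<^sup>+r. ennreal (?f r) * indicator (sector (\<phi> + \<alpha>) (\<phi> + \<beta>)) r \<partial>lborel)"
    by (rule nn_integral_cong_AE, use AE_lborel_singleton[of 0] in eventually_elim) (simp add: indicator_def)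
  also have "\<dots> = ennreal v * (\<integral>\<^sup>+z. ennreal (?f (c * z)) * indicator (sector (\<phi> + \<alpha>) (\<phi> + \<beta>)) (c * z) \<partial>lborel)"
    unfolding c(2)[symmetric] by (rule nn_integral_complex_mult) (use c in auto)
  also have "\<dots> = (\<integral>\<^sup>+z. ennreal v * (ennreal (?f (c * z)) * indicator (sector (\<phi> + \<alpha>) (\<phi> + \<beta>)) (c * z)) \<partial>lborel)"
    by (rule nn_integral_cmult[symmetric]) simp
  also have "\<dots> = (\<integral>\<^sup>+z. ennreal (exp (- (cmod (z - complex_of_real a))\<^sup>2) / pi) * indicator (sector \<alpha> \<beta>) z \<partial>lborel)"
  proof (rule nn_integral_cong)
    fix z
    have "c * z \<in> sector (\<phi> + \<alpha>) (\<phi> + \<beta>) \<longleftrightarrow> z \<in> sector \<alpha> \<beta>"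
      using v by (simp only: c_def mult.assoc sector_scale real_sqrt_gt_0_iff sector_rotate) simp
    then show "ennreal v * (ennreal (?f (c * z)) * indicator (sector (\<phi> + \<alpha>) (\<phi> + \<beta>)) (c * z)) =
        ennreal (exp (- (cmod (z - complex_of_real a))\<^sup>2) / pi) * indicator (sector \<alpha> \<beta>) z"
      using v by (simp add: indicator_def ennreal_mult'[symmetric] density)
  qed
  also have "\<dots> = ennreal (sector_prob \<alpha> \<beta> a)"
    by (rule nn_integral_gauss_sector[OF \<alpha>\<beta>])
  finally show ?thesis
    using sector_prob_pos[OF \<alpha>\<beta>(1), of a]
    by (simp add: psk_trans_prob_def measure_def s_def \<alpha>_def \<beta>_def a_def w_def)
qed

section \<open>Second-order expansions at zero\<close>

text \<open>The Peano form f x = c0 + c1 x + c2 x^2 + o(x^2) as x decreases to 0. Being a limit at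
  the punctured right neighbourhood, it applies directly to quotients by x, whatever their default
  value at 0.\<close>

definition expands :: "(real \<Rightarrow> real) \<Rightarrow> real \<Rightarrow> real \<Rightarrow> real \<Rightarrow> bool" where
  "expands f c0 c1 c2 \<longleftrightarrow> ((\<lambda>x. (f x - (c0 + c1 * x + c2 * x\<^sup>2)) / x\<^sup>2) \<longlongrightarrow> 0) (at_right 0)"

lemma expands_cong:
  assumes "expands f a0 a1 a2" "\<And>x. 0 < x \<Longrightarrow> f x = g x" "a0 = b0" "a1 = b1" "a2 = b2"
  shows "expands g b0 b1 b2"
  using assms(1) unfolding expands_def assms(3-5)
  by (rule Lim_transform_eventually) (use eventually_at_right_less[of "0 :: real"] in eventually_elim, simp add: assms(2))

lemma expands_polynomial: "expands (\<lambda>x. c0 + c1 * x + c2 * x\<^sup>2) c0 c1 c2"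
  by (simp add: expands_def)

lemma expands_const: "expands (\<lambda>x. c) c 0 0"
  using expands_polynomial[of c 0 0] by simp

lemma expands_id: "expands (\<lambda>x. x) 0 1 0"
  using expands_polynomial[of 0 1 0] by simp

lemma expands_add:
  assumes "expands f a0 a1 a2" "expands g b0 b1 b2"
  shows "expands (\<lambda>x. f x + g x) (a0 + b0) (a1 + b1) (a2 + b2)"
  using tendsto_add[OF assms[unfolded expands_def]]
  by (simp add: expands_def add_divide_distrib[symmetric] algebra_simps)

lemma expands_mult:
  assumes "expands f a0 a1 a2" "expands g b0 b1 b2"
  shows "expands (\<lambda>x. f x * g x) (a0 * b0) (a0 * b1 + a1 * b0) (a0 * b2 + a1 * b1 + a2 * b0)"
proof -
  define p q where "p x = a0 + a1 * x + a2 * x\<^sup>2" and "q x = b0 + b1 * x + b2 * x\<^sup>2" for x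
  define r s where "r x = (f x - p x) / x\<^sup>2" and "s x = (g x - q x) / x\<^sup>2" for x
  have r: "(r \<longlongrightarrow> 0) (at_right 0)" and s: "(s \<longlongrightarrow> 0) (at_right 0)"
    using assms by (simp_all add: expands_def r_def[abs_def] s_def[abs_def] p_def q_def)
  have p: "(p \<longlongrightarrow> a0 + a1 * 0 + a2 * 0\<^sup>2) (at_right 0)" and q: "(q \<longlongrightarrow> b0 + b1 * 0 + b2 * 0\<^sup>2) (at_right 0)"
    unfolding p_def[abs_def] q_def[abs_def] by (intro tendsto_intros)+
  \<comment> \<open>Writing f = p + x^2 r and g = q + x^2 s, this function is the part of f g beyond
    order two, divided by x^2.\<close>
  have "((\<lambda>x. (a1 * b2 + a2 * b1) * x + a2 * b2 * x\<^sup>2 + r x * q x + p x * s x + x\<^sup>2 * r x * s x)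
      \<longlongrightarrow> (a1 * b2 + a2 * b1) * 0 + a2 * b2 * 0\<^sup>2 + 0 * (b0 + b1 * 0 + b2 * 0\<^sup>2)
         + (a0 + a1 * 0 + a2 * 0\<^sup>2) * 0 + 0\<^sup>2 * 0 * 0) (at_right 0)"
    by (intro tendsto_intros p q r s)
  then have "((\<lambda>x. (a1 * b2 + a2 * b1) * x + a2 * b2 * x\<^sup>2 + r x * q x + p x * s x + x\<^sup>2 * r x * s x)
      \<longlongrightarrow> 0) (at_right 0)" by simp
  then show ?thesis unfolding expands_def
  proof (rule Lim_transform_eventually)
    show "\<forall>\<^sub>F x in at_right 0. (a1 * b2 + a2 * b1) * x + a2 * b2 * x\<^sup>2 + r x * q x + p x * s x + x\<^sup>2 * r x * s x =
      (f x * g x - (a0 * b0 + (a0 * b1 + a1 * b0) * x + (a0 * b2 + a1 * b1 + a2 * b0) * x\<^sup>2)) / x\<^sup>2"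
      using eventually_at_right_less[of "0 :: real"]
    proof eventually_elim
      fix x :: real assume x: "0 < x"
      then have fx: "f x = p x + x\<^sup>2 * r x" and gx: "g x = q x + x\<^sup>2 * s x"
        by (simp_all add: r_def s_def)
      show "(a1 * b2 + a2 * b1) * x + a2 * b2 * x\<^sup>2 + r x * q x + p x * s x + x\<^sup>2 * r x * s x =
        (f x * g x - (a0 * b0 + (a0 * b1 + a1 * b0) * x + (a0 * b2 + a1 * b1 + a2 * b0) * x\<^sup>2)) / x\<^sup>2"
        using x unfolding fx gx p_def q_def
        by (simp add: eq_divide_eq) algebra
    qed
  qed
qed

lemma expands_cmult: "expands f a0 a1 a2 \<Longrightarrow> expands (\<lambda>x. c * f x) (c * a0) (c * a1) (c * a2)"
  by (rule expands_cong[OF expands_mult[OF expands_const[of c]]], assumption) simp_all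

lemma expands_diff:
  assumes "expands f a0 a1 a2" "expands g b0 b1 b2"
  shows "expands (\<lambda>x. f x - g x) (a0 - b0) (a1 - b1) (a2 - b2)"
  using expands_add[OF assms(1) expands_cmult[OF assms(2), of "- 1"]] by simp

lemma expands_sum:
  assumes "\<And>i. i \<in> I \<Longrightarrow> expands (f i) (a0 i) (a1 i) (a2 i)"
  shows "expands (\<lambda>x. \<Sum>i\<in>I. f i x) (\<Sum>i\<in>I. a0 i) (\<Sum>i\<in>I. a1 i) (\<Sum>i\<in>I. a2 i)"
  using assms
  by (induction I rule: infinite_finite_induct) (auto intro!: expands_add expands_const)

lemma expands_tendsto:
  assumes "expands f a0 a1 a2"
  shows "(f \<longlongrightarrow> a0) (at_right 0)"
proof -
  have "((\<lambda>x. (f x - (a0 + a1 * x + a2 * x\<^sup>2)) / x\<^sup>2 * x\<^sup>2 + (a0 + a1 * x + a2 * x\<^sup>2)) \<longlongrightarrow>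
      0 * 0\<^sup>2 + (a0 + a1 * 0 + a2 * 0\<^sup>2)) (at_right 0)"
    by (intro tendsto_intros assms[unfolded expands_def])
  then have "((\<lambda>x. (f x - (a0 + a1 * x + a2 * x\<^sup>2)) / x\<^sup>2 * x\<^sup>2 + (a0 + a1 * x + a2 * x\<^sup>2)) \<longlongrightarrow> a0) (at_right 0)"
    by simp
  then show ?thesis
    by (rule Lim_transform_eventually) (use eventually_at_right_less[of "0 :: real"] in eventually_elim, simp)
qed

text \<open>The coefficients of the quotient are proposed by the caller and only checked against the
  Cauchy product with g. Then f - c g = o(x^2), and dividing by g, whose limit \<open>b0\<close> is
  nonzero, preserves this.\<close>

lemma expands_divide:
  assumes f: "expands f a0 a1 a2" and g: "expands g b0 b1 b2" and b0: "b0 \<noteq> 0"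
    and a: "a0 = c0 * b0" "a1 = c0 * b1 + c1 * b0" "a2 = c0 * b2 + c1 * b1 + c2 * b0"
  shows "expands (\<lambda>x. f x / g x) c0 c1 c2"
proof -
  let ?c = "\<lambda>x. c0 + c1 * x + c2 * x\<^sup>2"
  have "expands (\<lambda>x. f x - ?c x * g x) 0 0 0"
    by (rule expands_cong[OF expands_diff[OF f expands_mult[OF expands_polynomial g]]]) (simp_all add: a)
  then have "((\<lambda>x. (f x - ?c x * g x) / x\<^sup>2 / g x) \<longlongrightarrow> 0 / b0) (at_right 0)"
    by (intro tendsto_divide expands_tendsto[OF g] b0) (simp add: expands_def)
  then have "((\<lambda>x. (f x - ?c x * g x) / x\<^sup>2 / g x) \<longlongrightarrow> 0) (at_right 0)" by simp
  then show ?thesis unfolding expands_def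
  proof (rule Lim_transform_eventually)
    show "\<forall>\<^sub>F x in at_right 0. (f x - ?c x * g x) / x\<^sup>2 / g x = (f x / g x - ?c x) / x\<^sup>2"
      using tendsto_imp_eventually_ne[OF expands_tendsto[OF g] b0]
      by eventually_elim (simp add: field_simps)
  qed
qed

text \<open>By l'Hopital's rule, the remainder of F over x^3 tends to 0 because that of f over x^2
  does. The quotient by x is essential: it retains the cubic coefficient of F, which an expansion of
  F itself to second order would discard.\<close>

lemma expands_integral:
  assumes f: "expands f a0 a1 a2" and F: "\<And>x. (F has_real_derivative f x) (at x)"
  shows "expands (\<lambda>x. (F x - F 0) / x) a0 (a1 / 2) (a2 / 3)"
proof -
  let ?N = "\<lambda>x. F x - F 0 - (a0 * x + a1 / 2 * x\<^sup>2 + a2 / 3 * x ^ 3)"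
  have "((\<lambda>x. ?N x / x ^ 3) \<longlongrightarrow> 0) (at_right 0)"
  proof (rule lhopital_right_0)
    have "isCont F 0" using F DERIV_isCont by blast
    then have "(F \<longlongrightarrow> F 0) (at_right 0)"
      by (simp add: isCont_def filterlim_at_split)
    then have "(?N \<longlongrightarrow> F 0 - F 0 - (a0 * 0 + a1 / 2 * 0\<^sup>2 + a2 / 3 * 0 ^ 3)) (at_right 0)"
      by (intro tendsto_intros)
    then show "(?N \<longlongrightarrow> 0) (at_right 0)" by simp
    have "((\<lambda>x :: real. x ^ 3) \<longlongrightarrow> 0 ^ 3) (at_right 0)" by (intro tendsto_intros)
    then show "((\<lambda>x :: real. x ^ 3) \<longlongrightarrow> 0) (at_right 0)" by simp
    show "\<forall>\<^sub>F x in at_right 0. DERIV ?N x :> f x - (a0 + a1 * x + a2 * x\<^sup>2)"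
      by (intro always_eventually allI) (auto intro!: derivative_eq_intros F)
    show "\<forall>\<^sub>F x in at_right 0. DERIV (\<lambda>x :: real. x ^ 3) x :> 3 * x\<^sup>2"
      by (intro always_eventually allI) (auto intro!: derivative_eq_intros)
    show "\<forall>\<^sub>F x in at_right 0. (x :: real) ^ 3 \<noteq> 0" "\<forall>\<^sub>F x in at_right 0. 3 * (x :: real)\<^sup>2 \<noteq> 0"
      by (use eventually_at_right_less[of "0 :: real"] in eventually_elim, simp)+
    have "((\<lambda>x. (f x - (a0 + a1 * x + a2 * x\<^sup>2)) / x\<^sup>2 / 3) \<longlongrightarrow> 0 / 3) (at_right 0)"
      by (intro tendsto_intros f[unfolded expands_def]) simp
    then show "((\<lambda>x. (f x - (a0 + a1 * x + a2 * x\<^sup>2)) / (3 * x\<^sup>2)) \<longlongrightarrow> 0) (at_right 0)"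
      by (simp add: mult.commute)
  qed
  then show ?thesis unfolding expands_def
  proof (rule Lim_transform_eventually)
    show "\<forall>\<^sub>F x in at_right 0. ?N x / x ^ 3 = ((F x - F 0) / x - (a0 + a1 / 2 * x + a2 / 3 * x\<^sup>2)) / x\<^sup>2"
      using eventually_at_right_less[of "0 :: real"]
      by eventually_elim (simp add: field_simps power2_eq_square power3_eq_cube)
  qed
qed

lemma expands_integral':
  assumes "expands f a0 a1 a2" and "\<And>x. (F has_real_derivative f x) (at x)"
  shows "expands F (F 0) a0 (a1 / 2)"
  by (rule expands_cong[OF expands_add[OF expands_const expands_mult[OF expands_id expands_integral[OF assms]]], of "F 0"])
    simp_all

text \<open>This is the difference quotient of exp at 0, composed with -(k x)^2. The composition
  requires an argument that avoids 0, hence the separate case k = 0.\<close>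

lemma expands_exp_square: "expands (\<lambda>x. exp (- (k * x)\<^sup>2)) 1 0 (- k\<^sup>2)"
proof (cases "k = 0")
  case True
  then show ?thesis using expands_const[of 1] by simp
next
  case False
  have "((\<lambda>h :: real. (exp (0 + h) - exp 0) / h) \<longlongrightarrow> exp 0) (at 0)"
    using DERIV_exp[of "0 :: real"] unfolding DERIV_def .
  then have *: "((\<lambda>h :: real. (exp h - 1) / h) \<longlongrightarrow> 1) (at 0)" by simp
  have "((\<lambda>x. - (k * x)\<^sup>2) \<longlongrightarrow> - (k * 0)\<^sup>2) (at_right 0)" by (intro tendsto_intros)
  then have "filterlim (\<lambda>x. - (k * x)\<^sup>2) (at 0) (at_right 0)"
    unfolding filterlim_at
    by (intro conjI) (use eventually_at_right_less[of "0 :: real"] in \<open>eventually_elim, use False in simp\<close>, simp)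
  from filterlim_compose[OF * this]
  have "((\<lambda>x. (exp (- (k * x)\<^sup>2) - 1) / - (k * x)\<^sup>2) \<longlongrightarrow> 1) (at_right 0)" .
  then have "((\<lambda>x. - k\<^sup>2 * ((exp (- (k * x)\<^sup>2) - 1) / - (k * x)\<^sup>2 - 1)) \<longlongrightarrow> - k\<^sup>2 * (1 - 1)) (at_right 0)"
    by (intro tendsto_intros)
  then have "((\<lambda>x. - k\<^sup>2 * ((exp (- (k * x)\<^sup>2) - 1) / - (k * x)\<^sup>2 - 1)) \<longlongrightarrow> 0) (at_right 0)"
    by simp
  then show ?thesis unfolding expands_def
    by (rule Lim_transform_eventually)
      (use eventually_at_right_less[of "0 :: real"] in \<open>eventually_elim, use False in \<open>simp add: field_simps power_mult_distrib\<close>\<close>)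
qed

lemma expands_gauss_primitive: "expands (\<lambda>x. gauss_primitive (x * k)) 0 k 0"
proof -
  have "((\<lambda>x. gauss_primitive (x * k)) has_real_derivative k * exp (- (k * x)\<^sup>2)) (at x)" for x
    by (auto intro!: derivative_eq_intros simp: mult_ac)
  from expands_integral'[OF expands_cmult[OF expands_exp_square] this]
  show ?thesis by simp
qed

lemma expands_phase_flux:
  "expands (\<lambda>a. phase_flux a \<theta>) (sin \<theta> * (sqrt pi / 2)) (sin \<theta> * cos \<theta>) (- (sin \<theta> ^ 3) * (sqrt pi / 2))"
proof -
  have "expands (\<lambda>a. (sin \<theta> * exp (- (sin \<theta> * a)\<^sup>2)) * (sqrt pi / 2 + gauss_primitive (a * cos \<theta>)))
      (sin \<theta> * (sqrt pi / 2)) (sin \<theta> * cos \<theta>) (- (sin \<theta> ^ 3) * (sqrt pi / 2))"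
    by (rule expands_cong[OF expands_mult[OF expands_cmult[OF expands_exp_square[of "sin \<theta>"], of "sin \<theta>"]
          expands_add[OF expands_const[of "sqrt pi / 2"] expands_gauss_primitive[of "cos \<theta>"]]]])
      (simp_all add: power2_eq_square power3_eq_cube)
  then show ?thesis by (simp add: phase_flux_def mult_ac)
qed

text \<open>The real part of the geometric sum of the powers of z = \<open>cis\<close> (2 pi k / M):
  always z^M = 1, and z = 1 exactly when M divides k.\<close>

lemma sum_cos_roots_of_unity:
  assumes "0 < M"
  shows "(\<Sum>l<M. cos (real k * (2 * pi * real l / real M))) = (if M dvd k then real M else 0)"
proof -
  define z where "z = cis (2 * pi * real k / real M)"
  have turn: "cis (2 * pi * real n) = 1" for n
    using cos_2npi[of n] sin_2npi[of n] by (simp add: complex_eq_iff mult_ac)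
  have pow: "cis (real k * (2 * pi * real l / real M)) = z ^ l" for l
  proof -
    have "z ^ l = cis (real l * (2 * pi * real k / real M))"
      by (simp only: z_def Complex.DeMoivre)
    also have "real l * (2 * pi * real k / real M) = real k * (2 * pi * real l / real M)"
      by (simp add: mult_ac)
    finally show ?thesis ..
  qed
  have "(\<Sum>l<M. z ^ l) = (if M dvd k then of_nat M else 0)"
  proof (cases "M dvd k")
    case True
    then obtain n where "k = M * n" by blast
    then have "z = cis (2 * pi * real n)" using assms by (simp add: z_def mult_ac)
    also have "\<dots> = 1" by (rule turn)
    finally show ?thesis using True by simp
  next
    case False
    have "z \<noteq> 1"
    proof
      assume "z = 1"
      then have "cos (2 * pi * real k / real M) = 1" by (simp add: z_def complex_eq_iff)
      then obtain n :: int where "2 * pi * real k / real M = real_of_int n * 2 * pi"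
        unfolding cos_one_2pi_int by blast
      then have "real_of_int (int k) = real_of_int (n * int M)" using assms by (simp add: field_simps)
      then have "int k = n * int M" by (simp only: of_int_eq_iff)
      then have "int M dvd int k" by simp
      with False show False by simp
    qed
    moreover have "z ^ M = cis (2 * pi * real k)" using assms by (simp add: z_def Complex.DeMoivre mult_ac)
    then have "z ^ M = 1" by (simp only: turn)
    ultimately show ?thesis using False by (simp add: geometric_sum)
  qed
  then have "Re (\<Sum>l<M. cis (real k * (2 * pi * real l / real M))) = (if M dvd k then real M else 0)"
    unfolding pow by simp
  then show ?thesis by simp
qed

section \<open>The information as a function of the amplitude\<close>

text \<open>The lower edge of sector l. Its upper edge is the value at \<open>Suc l\<close>, so that
  sums of edge differences telescope.\<close>

definition psk_boundary :: "nat \<Rightarrow> nat \<Rightarrow> real" where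
  "psk_boundary M l = (2 * real l - 1) * pi / real M"

definition psk_prob :: "nat \<Rightarrow> nat \<Rightarrow> real \<Rightarrow> real" where
  "psk_prob M l = sector_prob (psk_boundary M l) (psk_boundary M (Suc l))"

definition psk_prob_deriv :: "nat \<Rightarrow> nat \<Rightarrow> real \<Rightarrow> real" where
  "psk_prob_deriv M l a = (phase_flux a (psk_boundary M (Suc l)) - phase_flux a (psk_boundary M l)) / pi"

definition psk_info :: "nat \<Rightarrow> real \<Rightarrow> real" where
  "psk_info M a = ln (real M) + (\<Sum>l<M. psk_prob M l a * ln (psk_prob M l a))"

text \<open>With the factor M each logarithm vanishes at a = 0, where every probability is 1 / M;
  this is what keeps the quotient by a bounded near 0.\<close>

definition psk_info_deriv :: "nat \<Rightarrow> real \<Rightarrow> real" where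
  "psk_info_deriv M a = (\<Sum>l<M. psk_prob_deriv M l a * ln (real M * psk_prob M l a))"

lemma psk_boundary_less: "0 < M \<Longrightarrow> psk_boundary M l < psk_boundary M (Suc l)"
  unfolding psk_boundary_def by (intro divide_strict_right_mono mult_strict_right_mono) auto

lemma psk_capacity_eq_psk_info:
  assumes "2 \<le> M" "0 < N0" "0 \<le> snr"
  shows "psk_capacity M d \<gamma> N0 snr = psk_info M (cmod d * sqrt (snr / (\<gamma>\<^sup>2 * snr + 1)))"
proof -
  have "psk_trans_prob M d \<gamma> (snr * N0) N0 l 0 = psk_prob M l (cmod d * sqrt (snr / (\<gamma>\<^sup>2 * snr + 1)))" for l
  proof -
    have "2 * real l + 1 = 2 * real (Suc l) - 1" by simp
    then show ?thesis
      using psk_trans_prob_eq_sector_prob[OF assms, of d \<gamma> l]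
      by (simp only: psk_prob_def psk_boundary_def)
  qed
  then show ?thesis by (simp only: psk_capacity_def psk_info_def)
qed

lemma psk_prob_pos: "0 < M \<Longrightarrow> 0 < psk_prob M l a"
  unfolding psk_prob_def by (intro sector_prob_pos psk_boundary_less)

lemma psk_prob_0: "0 < M \<Longrightarrow> psk_prob M l 0 = 1 / real M"
  using psk_boundary_less[of M l]
  by (simp add: psk_prob_def sector_prob_0) (simp add: psk_boundary_def field_simps)

lemma DERIV_psk_prob: "0 < M \<Longrightarrow> (psk_prob M l has_real_derivative psk_prob_deriv M l a) (at a)"
  unfolding psk_prob_def psk_prob_deriv_def
  by (intro DERIV_sector_prob less_imp_le psk_boundary_less)

text \<open>What leaves one sector enters the next: the sum telescopes, and the last edge is the
  first one turned by 2 pi, which leaves the flux unchanged.\<close>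

lemma sum_psk_prob_deriv:
  assumes "0 < M"
  shows "(\<Sum>l<M. psk_prob_deriv M l a) = 0"
proof -
  have "psk_boundary M M = psk_boundary M 0 + 2 * pi"
    using assms by (simp add: psk_boundary_def field_simps)
  then have "phase_flux a (psk_boundary M M) = phase_flux a (psk_boundary M 0)"
    by (simp add: phase_flux_def)
  then show ?thesis
    unfolding psk_prob_deriv_def sum_divide_distrib[symmetric]
    using sum_lessThan_telescope[of "\<lambda>l. phase_flux a (psk_boundary M l)" M] by simp
qed

lemma DERIV_psk_info:
  assumes M: "0 < M"
  shows "(psk_info M has_real_derivative psk_info_deriv M a) (at a)"
proof -
  have "(psk_info M has_real_derivative
      (\<Sum>l<M. psk_prob_deriv M l a * ln (psk_prob M l a) + psk_prob_deriv M l a)) (at a)"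
    unfolding psk_info_def[abs_def]
    by (auto intro!: derivative_eq_intros DERIV_psk_prob M sum.cong simp: psk_prob_pos[OF M] less_imp_neq[OF psk_prob_pos[OF M], symmetric])
  \<comment> \<open>Differentiating p ln p leaves an extra p'. It is exchanged for ln M times p', as
    both sum to zero over the outputs.\<close>
  also have "(\<Sum>l<M. psk_prob_deriv M l a * ln (psk_prob M l a) + psk_prob_deriv M l a) =
      (\<Sum>l<M. psk_prob_deriv M l a * ln (psk_prob M l a) + ln (real M) * psk_prob_deriv M l a)"
    by (simp add: sum.distrib sum_distrib_left[symmetric] sum_psk_prob_deriv[OF M])
  also have "\<dots> = psk_info_deriv M a"
    unfolding psk_info_deriv_def using M
    by (intro sum.cong) (simp_all add: ln_mult psk_prob_pos less_imp_neq[OF psk_prob_pos, symmetric] algebra_simps)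
  finally show ?thesis .
qed

text \<open>Because F 0 = 1 / m, the function ln (m F) is the primitive of f / F that vanishes at 0.
  Dividing by x, its expansion is that of f / F with the coefficients divided by 1, 2, 3; the stated
  constants are the Cauchy product of this with f.\<close>

lemma expands_deriv_mult_ln:
  assumes f: "expands f e0 e1 e2" and F: "\<And>x. (F has_real_derivative f x) (at x)"
    and pos: "\<And>x. 0 < F x" and F0: "F 0 = 1 / m" and m: "0 < m"
  shows "expands (\<lambda>x. f x * ln (m * F x) / x)
    (m * e0\<^sup>2) (m * (3 / 2 * (e0 * e1) - m / 2 * e0 ^ 3))
    (m * (4 / 3 * (e0 * e2) + e1\<^sup>2 / 2 - m * (e0\<^sup>2 * e1) + m\<^sup>2 / 3 * e0 ^ 4))"
proof -
  have G: "expands F (1 / m) e0 (e1 / 2)"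
    using expands_integral'[OF f F] by (simp add: F0)
  have L: "expands (\<lambda>x. f x / F x) (m * e0) (m * (e1 - m * e0\<^sup>2)) (m * (e2 - 3 / 2 * m * (e0 * e1) + m\<^sup>2 * e0 ^ 3))"
    by (rule expands_divide[OF f G]) (use m in \<open>simp_all add: field_simps power2_eq_square power3_eq_cube\<close>)
  have "((\<lambda>x. ln (m * F x)) has_real_derivative f x / F x) (at x)" for x
    using m pos[of x] by (auto intro!: derivative_eq_intros F simp: field_simps)
  from expands_mult[OF f expands_integral[OF L this]]
  show ?thesis
    by (rule expands_cong)
      (use m in \<open>simp_all add: F0 field_simps power2_eq_square power3_eq_cube power4_eq_xxxx\<close>)
qed

section \<open>Harmonic form of the probability derivatives and of the information\<close>

lemma sin_treble_sin: "sin (3 * x) = 3 * sin x - 4 * sin x ^ 3" for x :: real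
proof -
  have "sin (3 * x) = sin (2 * x + x)" by simp
  also have "\<dots> = 3 * sin x - 4 * sin x ^ 3"
    unfolding sin_add sin_double cos_double_sin using sin_cos_squared_add[of x] by algebra
  finally show ?thesis .
qed

text \<open>The three flux coefficients involve sin \<theta>, sin \<theta> cos \<theta> = sin (2
  \<theta>) / 2 and sin^3 \<theta> = (3 sin \<theta> - sin (3 \<theta>)) / 4. Differences of sin (k
  \<theta>) between the edges \<phi> + \<delta> and \<phi> - \<delta> are 2 sin (k \<delta>) cos (k
  \<phi>), so the output index enters only through harmonics cos (k \<phi>).\<close>

lemma expands_psk_prob_deriv:
  fixes M l :: nat
  defines "\<delta> \<equiv> pi / real M" and "\<phi> \<equiv> 2 * pi * real l / real M"
  shows "expands (psk_prob_deriv M l) (sin \<delta> / sqrt pi * cos \<phi>) (sin (2 * \<delta>) / pi * cos (2 * \<phi>))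
    ((sin (3 * \<delta>) * cos (3 * \<phi>) - 3 * sin \<delta> * cos \<phi>) / (4 * sqrt pi))"
proof -
  have b: "psk_boundary M (Suc l) = \<phi> + \<delta>" "psk_boundary M l = \<phi> - \<delta>"
    by (simp_all add: psk_boundary_def \<delta>_def \<phi>_def diff_divide_distrib[symmetric] add_divide_distrib[symmetric] algebra_simps)
  have s1: "sin (\<phi> + \<delta>) - sin (\<phi> - \<delta>) = 2 * sin \<delta> * cos \<phi>"
    by (simp add: sin_add sin_diff)
  have s2: "sin (\<phi> + \<delta>) * cos (\<phi> + \<delta>) - sin (\<phi> - \<delta>) * cos (\<phi> - \<delta>) = sin (2 * \<delta>) * cos (2 * \<phi>)"
  proof -
    have "sin (2 * \<phi> + 2 * \<delta>) - sin (2 * \<phi> - 2 * \<delta>) = 2 * sin (2 * \<delta>) * cos (2 * \<phi>)"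
      by (simp add: sin_add sin_diff)
    moreover have "sin (2 * \<phi> + 2 * \<delta>) = 2 * sin (\<phi> + \<delta>) * cos (\<phi> + \<delta>)"
      "sin (2 * \<phi> - 2 * \<delta>) = 2 * sin (\<phi> - \<delta>) * cos (\<phi> - \<delta>)"
      using sin_double[of "\<phi> + \<delta>"] sin_double[of "\<phi> - \<delta>"] by (simp_all add: algebra_simps)
    ultimately show ?thesis by simp
  qed
  have s3: "sin (\<phi> + \<delta>) ^ 3 - sin (\<phi> - \<delta>) ^ 3 = (3 * sin \<delta> * cos \<phi> - sin (3 * \<delta>) * cos (3 * \<phi>)) / 2"
  proof -
    have "sin (3 * \<phi> + 3 * \<delta>) - sin (3 * \<phi> - 3 * \<delta>) = 2 * sin (3 * \<delta>) * cos (3 * \<phi>)"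
      by (simp add: sin_add sin_diff)
    moreover have "sin (3 * \<phi> + 3 * \<delta>) = 3 * sin (\<phi> + \<delta>) - 4 * sin (\<phi> + \<delta>) ^ 3"
      "sin (3 * \<phi> - 3 * \<delta>) = 3 * sin (\<phi> - \<delta>) - 4 * sin (\<phi> - \<delta>) ^ 3"
      using sin_treble_sin[of "\<phi> + \<delta>"] sin_treble_sin[of "\<phi> - \<delta>"] by (simp_all add: algebra_simps)
    ultimately show ?thesis using s1 by simp
  qed
  have pi: "1 / pi * (x * (sqrt pi / 2)) = x / (2 * sqrt pi)" for x
    by (simp add: field_simps)
  have "expands (\<lambda>a. 1 / pi * (phase_flux a (\<phi> + \<delta>) - phase_flux a (\<phi> - \<delta>)))
      (1 / pi * ((sin (\<phi> + \<delta>) - sin (\<phi> - \<delta>)) * (sqrt pi / 2)))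
      (1 / pi * (sin (\<phi> + \<delta>) * cos (\<phi> + \<delta>) - sin (\<phi> - \<delta>) * cos (\<phi> - \<delta>)))
      (1 / pi * (- (sin (\<phi> + \<delta>) ^ 3 - sin (\<phi> - \<delta>) ^ 3) * (sqrt pi / 2)))"
    by (rule expands_cong[OF expands_cmult[OF expands_diff[OF
        expands_phase_flux[of "\<phi> + \<delta>"] expands_phase_flux[of "\<phi> - \<delta>"]], of "1 / pi"]])
      (simp_all add: algebra_simps)
  then show ?thesis
    unfolding s1 s2 s3 pi
    by (rule expands_cong) (simp_all add: psk_prob_deriv_def b field_simps)
qed
text \<open>\<open>\<sigma> k\<close> is the sum over l of cos (2 pi k l / M). Each coefficient of a
  single output is a polynomial in such cosines; linearising it into harmonics up to 4 reduces the
  sum over the outputs to these values.\<close>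

lemma expands_psk_info_deriv:
  fixes M :: nat
  defines "s1 \<equiv> sin (pi / real M)" and "s2 \<equiv> sin (2 * (pi / real M))" and "s3 \<equiv> sin (3 * (pi / real M))"
    and "\<sigma> \<equiv> \<lambda>k. if M dvd k then real M else 0"
  assumes M: "0 < M"
  shows "expands (\<lambda>a. psk_info_deriv M a / a)
    (real M * s1\<^sup>2 / (2 * pi) * (real M + \<sigma> 2))
    (real M / (pi * sqrt pi) * (3 / 4 * s1 * s2 * (\<sigma> 1 + \<sigma> 3) - real M / 8 * s1 ^ 3 * (3 * \<sigma> 1 + \<sigma> 3)))
    (real M * (s1 * (s3 * (\<sigma> 2 + \<sigma> 4) - 3 * s1 * (real M + \<sigma> 2)) / (6 * pi)
      + s2\<^sup>2 * (real M + \<sigma> 4) / (4 * pi\<^sup>2)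
      - real M * s1\<^sup>2 * s2 * (real M + 2 * \<sigma> 2 + \<sigma> 4) / (4 * pi\<^sup>2)
      + (real M)\<^sup>2 * s1 ^ 4 * (3 * real M + 4 * \<sigma> 2 + \<sigma> 4) / (24 * pi\<^sup>2)))"
proof -
  define c where "c k l = cos (real k * (2 * pi * real l / real M))" for k l
  define e0 e1 e2 where "e0 l = s1 / sqrt pi * c 1 l" and "e1 l = s2 / pi * c 2 l"
    and "e2 l = (s3 * c 3 l - 3 * s1 * c 1 l) / (4 * sqrt pi)" for l
  \<comment> \<open>With a name for the root, pi becomes r^2 and mixed powers of pi and sqrt pi turn
    into rational expressions in r.\<close>
  define r where "r = sqrt pi"
  have r: "pi = r\<^sup>2" "r \<noteq> 0" by (simp_all add: r_def)
  \<comment> \<open>Chebyshev identities: they make every harmonic a polynomial in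
    \<open>c 1 l\<close>, so the linearisations below become polynomial identities.\<close>
  have c2: "c 2 l = 2 * (c 1 l)\<^sup>2 - 1" and c3: "c 3 l = 4 * (c 1 l) ^ 3 - 3 * c 1 l"
    and c4: "c 4 l = 2 * (c 2 l)\<^sup>2 - 1" for l
  proof -
    let ?x = "2 * pi * real l / real M"
    show "c 2 l = 2 * (c 1 l)\<^sup>2 - 1"
      using cos_double_cos[of ?x] by (simp add: c_def)
    show "c 3 l = 4 * (c 1 l) ^ 3 - 3 * c 1 l"
      using cos_treble_cos[of ?x] by (simp add: c_def)
    show "c 4 l = 2 * (c 2 l)\<^sup>2 - 1"
      using cos_double_cos[of "2 * ?x"] by (simp add: c_def)
  qed
  have lin: "(\<Sum>l<M. x0 + x1 * c 1 l + x2 * c 2 l + x3 * c 3 l + x4 * c 4 l) =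
      x0 * real M + x1 * \<sigma> 1 + x2 * \<sigma> 2 + x3 * \<sigma> 3 + x4 * \<sigma> 4" for x0 x1 x2 x3 x4
    unfolding sum.distrib sum_distrib_left[symmetric] c_def sum_cos_roots_of_unity[OF M] \<sigma>_def by simp
  have "expands (\<lambda>a. psk_prob_deriv M l a * ln (real M * psk_prob M l a) / a)
    (real M * (e0 l)\<^sup>2) (real M * (3 / 2 * (e0 l * e1 l) - real M / 2 * e0 l ^ 3))
    (real M * (4 / 3 * (e0 l * e2 l) + (e1 l)\<^sup>2 / 2 - real M * ((e0 l)\<^sup>2 * e1 l) + (real M)\<^sup>2 / 3 * e0 l ^ 4))" for l
  proof (rule expands_deriv_mult_ln)
    show "expands (psk_prob_deriv M l) (e0 l) (e1 l) (e2 l)"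
      using expands_psk_prob_deriv[of M l] by (simp add: e0_def e1_def e2_def c_def s1_def s2_def s3_def)
  qed (use M in \<open>simp_all add: DERIV_psk_prob psk_prob_pos psk_prob_0\<close>)
  then have "expands (\<lambda>a. \<Sum>l<M. psk_prob_deriv M l a * ln (real M * psk_prob M l a) / a)
    (\<Sum>l<M. real M * (e0 l)\<^sup>2) (\<Sum>l<M. real M * (3 / 2 * (e0 l * e1 l) - real M / 2 * e0 l ^ 3))
    (\<Sum>l<M. real M * (4 / 3 * (e0 l * e2 l) + (e1 l)\<^sup>2 / 2 - real M * ((e0 l)\<^sup>2 * e1 l) + (real M)\<^sup>2 / 3 * e0 l ^ 4))"
    by (rule expands_sum)
  then show ?thesis
  proof (rule expands_cong)
    show "(\<Sum>l<M. psk_prob_deriv M l a * ln (real M * psk_prob M l a) / a) = psk_info_deriv M a / a" for a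
      by (simp add: psk_info_deriv_def sum_divide_distrib)
    have "(\<Sum>l<M. real M * (e0 l)\<^sup>2) = (\<Sum>l<M. real M * s1\<^sup>2 / (2 * pi) + 0 * c 1 l
        + real M * s1\<^sup>2 / (2 * pi) * c 2 l + 0 * c 3 l + 0 * c 4 l)"
      by (intro sum.cong refl) (simp add: e0_def c2 field_simps)
    then show "(\<Sum>l<M. real M * (e0 l)\<^sup>2) = real M * s1\<^sup>2 / (2 * pi) * (real M + \<sigma> 2)"
      unfolding lin by (simp add: distrib_left)
    let ?k = "real M / (pi * sqrt pi)"
    have "(\<Sum>l<M. real M * (3 / 2 * (e0 l * e1 l) - real M / 2 * e0 l ^ 3)) =
      (\<Sum>l<M. 0 + ?k * (3 / 4 * s1 * s2 - 3 * real M / 8 * s1 ^ 3) * c 1 l + 0 * c 2 l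
        + ?k * (3 / 4 * s1 * s2 - real M / 8 * s1 ^ 3) * c 3 l + 0 * c 4 l)"
      unfolding e0_def e1_def c2 c3 r_def[symmetric] using r
      by (intro sum.cong refl) (simp add: field_simps power2_eq_square power3_eq_cube)
    also have "\<dots> = ?k * (3 / 4 * s1 * s2 * (\<sigma> 1 + \<sigma> 3) - real M / 8 * s1 ^ 3 * (3 * \<sigma> 1 + \<sigma> 3))"
      unfolding lin by (simp add: algebra_simps)
    finally show "(\<Sum>l<M. real M * (3 / 2 * (e0 l * e1 l) - real M / 2 * e0 l ^ 3)) = \<dots>" .
    \<comment> \<open>Prefactors of the four products after linearisation, where ck abbreviates
      \<open>c k l\<close>: c1 c3 = (c2 + c4) / 2 and c1^2 = (1 + c2) / 2 for \<open>?A\<close>,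
      c2^2 = (1 + c4) / 2 for \<open>?B\<close>, c1^2 c2 = (1 + 2 c2 + c4) / 4 for
      \<open>?C\<close>, c1^4 = (3 + 4 c2 + c4) / 8 for \<open>?D\<close>.\<close>
    let ?A = "real M * s1 / (6 * pi)" and ?B = "real M * s2\<^sup>2 / (4 * pi\<^sup>2)"
      and ?C = "(real M)\<^sup>2 * s1\<^sup>2 * s2 / (4 * pi\<^sup>2)" and ?D = "(real M) ^ 3 * s1 ^ 4 / (24 * pi\<^sup>2)"
    have "(\<Sum>l<M. real M * (4 / 3 * (e0 l * e2 l) + (e1 l)\<^sup>2 / 2 - real M * ((e0 l)\<^sup>2 * e1 l) + (real M)\<^sup>2 / 3 * e0 l ^ 4)) =
      (\<Sum>l<M. (?B - 3 * s1 * ?A - ?C + 3 * ?D) + 0 * c 1 l + (?A * s3 - 3 * s1 * ?A - 2 * ?C + 4 * ?D) * c 2 l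
        + 0 * c 3 l + (?A * s3 + ?B - ?C + ?D) * c 4 l)"
    proof (intro sum.cong refl)
      fix l
      have "e0 l * e2 l = s1 * c 1 l * (s3 * c 3 l - 3 * s1 * c 1 l) / (4 * pi)"
        "(e1 l)\<^sup>2 = s2\<^sup>2 * (c 2 l)\<^sup>2 / pi\<^sup>2" "(e0 l)\<^sup>2 * e1 l = s1\<^sup>2 * s2 * (c 1 l)\<^sup>2 * c 2 l / pi\<^sup>2"
        by (simp_all add: e0_def e1_def e2_def power_mult_distrib power_divide power2_eq_square[of pi])
      moreover have "e0 l ^ 4 = s1 ^ 4 * (c 1 l) ^ 4 / pi\<^sup>2"
        by (simp add: e0_def r_def[symmetric] r(1) power_mult_distrib power_divide flip: power_mult)
      ultimately show "real M * (4 / 3 * (e0 l * e2 l) + (e1 l)\<^sup>2 / 2 - real M * ((e0 l)\<^sup>2 * e1 l) + (real M)\<^sup>2 / 3 * e0 l ^ 4) =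
        (?B - 3 * s1 * ?A - ?C + 3 * ?D) + 0 * c 1 l + (?A * s3 - 3 * s1 * ?A - 2 * ?C + 4 * ?D) * c 2 l
        + 0 * c 3 l + (?A * s3 + ?B - ?C + ?D) * c 4 l"
        by (simp only: c4 c3 c2) (simp add: field_simps power2_eq_square power3_eq_cube power4_eq_xxxx)
    qed
    also have "\<dots> =
      real M * (s1 * (s3 * (\<sigma> 2 + \<sigma> 4) - 3 * s1 * (real M + \<sigma> 2)) / (6 * pi)
      + s2\<^sup>2 * (real M + \<sigma> 4) / (4 * pi\<^sup>2)
      - real M * s1\<^sup>2 * s2 * (real M + 2 * \<sigma> 2 + \<sigma> 4) / (4 * pi\<^sup>2)
      + (real M)\<^sup>2 * s1 ^ 4 * (3 * real M + 4 * \<sigma> 2 + \<sigma> 4) / (24 * pi\<^sup>2))"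
      unfolding lin by (simp add: field_simps power2_eq_square power3_eq_cube)
    finally show "(\<Sum>l<M. real M * (4 / 3 * (e0 l * e2 l) + (e1 l)\<^sup>2 / 2 - real M * ((e0 l)\<^sup>2 * e1 l) + (real M)\<^sup>2 / 3 * e0 l ^ 4)) =
      \<dots>" .
  qed
qed

section \<open>Derivatives with respect to the signal-to-noise ratio\<close>

text \<open>For a = D sqrt (s / w) with w = \<gamma>^2 s + 1, the derivative of a is D^2 / (2 a
  w^2), so C' = D^2 / (2 w^2) times f a / a. In the slope of C' at 0, the factor 1 / w^2 accounts
  for the \<gamma>^2 term, K2 a^2 for the D^4 term, and K1 a, of order sqrt s, for the possible
  blow-up.\<close>

lemma has_derivatives_snr:
  fixes F f C :: "real \<Rightarrow> real" and D \<gamma> K0 K1 K2 :: real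
  assumes F: "\<And>x. (F has_real_derivative f x) (at x)"
    and f: "expands (\<lambda>x. f x / x) K0 K1 K2" and D: "0 < D"
    and C: "\<And>s. 0 \<le> s \<Longrightarrow> C s = F (D * sqrt (s / (\<gamma>\<^sup>2 * s + 1)))"
  obtains C' where "\<And>s. 0 \<le> s \<Longrightarrow> (C has_real_derivative C' s) (at s within {0..})"
    and "C' 0 = D\<^sup>2 / 2 * K0"
    and "K1 = 0 \<Longrightarrow> (C' has_real_derivative D ^ 4 / 2 * K2 - D\<^sup>2 * \<gamma>\<^sup>2 * K0) (at 0 within {0..})"
    and "0 < K1 \<Longrightarrow> filterlim (\<lambda>s. (C' s - C' 0) / s) at_top (at_right 0)"
proof -
  define w where "w s = \<gamma>\<^sup>2 * s + 1" for s
  define a where "a s = D * sqrt (s / w s)" for s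
  \<comment> \<open>At s = 0 the quotient f a / a would be a division by zero with value 0, so its
    limit K0 is put in explicitly.\<close>
  define C' where "C' s = (if s = 0 then D\<^sup>2 / 2 * K0 else D\<^sup>2 / (2 * (w s)\<^sup>2) * (f (a s) / a s))" for s
  define \<rho> where "\<rho> x = (f x / x - (K0 + K1 * x + K2 * x\<^sup>2)) / x\<^sup>2" for x
  have wpos: "0 < w s" if "0 \<le> s" for s
    using that by (simp add: w_def add_nonneg_pos)
  have apos: "0 < a s" if "0 < s" for s
    using that D wpos[of s] by (simp add: a_def)
  have a0: "a 0 = 0" by (simp add: a_def)
  have a2: "(a s)\<^sup>2 = D\<^sup>2 * (s / w s)" if "0 < s" for s
    using that wpos[of s] by (simp add: a_def power_mult_distrib)
  have w_lim: "(w \<longlongrightarrow> 1) (at_right 0)"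
  proof -
    have "(w \<longlongrightarrow> \<gamma>\<^sup>2 * 0 + 1) (at_right 0)"
      unfolding w_def[abs_def] by (intro tendsto_intros)
    then show ?thesis by simp
  qed
  have a_lim: "filterlim a (at_right 0) (at_right 0)"
  proof -
    have "(a \<longlongrightarrow> D * sqrt (0 / 1)) (at_right 0)"
      unfolding a_def[abs_def] by (intro tendsto_intros w_lim) simp
    moreover have "\<forall>\<^sub>F s in at_right 0. a s \<in> {0<..} \<and> a s \<noteq> 0"
      using eventually_at_right_less[of "0 :: real"] by eventually_elim (use apos in force)
    ultimately show ?thesis by (simp add: filterlim_at)
  qed
  have Fa: "((\<lambda>s. F (a s)) has_real_derivative C' s) (at s)" if s: "0 < s" for s
  proof -
    have "((\<lambda>s. s / w s) has_real_derivative 1 / (w s)\<^sup>2) (at s)"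
      using wpos[of s] s unfolding w_def
      by (auto intro!: derivative_eq_intros simp: power2_eq_square field_simps)
    from DERIV_chain2[OF DERIV_real_sqrt this]
    have "((\<lambda>s. sqrt (s / w s)) has_real_derivative inverse (sqrt (s / w s)) / 2 * (1 / (w s)\<^sup>2)) (at s)"
      using wpos[of s] s by simp
    from DERIV_cmult[OF this, of D]
    have "(a has_real_derivative D * (inverse (sqrt (s / w s)) / 2 * (1 / (w s)\<^sup>2))) (at s)"
      by (simp add: a_def[abs_def])
    from DERIV_chain2[OF F this] have "((\<lambda>s. F (a s)) has_real_derivative
        f (a s) * (D * (inverse (sqrt (s / w s)) / 2 * (1 / (w s)\<^sup>2)))) (at s)" .
    moreover have "f (a s) * (D * (inverse (sqrt (s / w s)) / 2 * (1 / (w s)\<^sup>2))) = C' s"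
      using s D wpos[of s] apos[OF s] by (simp add: C'_def a_def field_simps power2_eq_square)
    ultimately show ?thesis by simp
  qed
  have C'_lim: "(C' \<longlongrightarrow> C' 0) (at_right 0)"
  proof -
    have "((\<lambda>s. D\<^sup>2 / (2 * (w s)\<^sup>2) * (f (a s) / a s)) \<longlongrightarrow> D\<^sup>2 / (2 * 1\<^sup>2) * K0) (at_right 0)"
      by (intro tendsto_intros w_lim filterlim_compose[OF expands_tendsto[OF f] a_lim]) simp
    moreover have "D\<^sup>2 / (2 * 1\<^sup>2) * K0 = C' 0" by (simp add: C'_def)
    ultimately have "((\<lambda>s. D\<^sup>2 / (2 * (w s)\<^sup>2) * (f (a s) / a s)) \<longlongrightarrow> C' 0) (at_right 0)" by simp
    then show ?thesis
      by (rule Lim_transform_eventually) (use eventually_at_right_less[of "0 :: real"] in eventually_elim, simp add: C'_def)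
  qed
  have "(C has_real_derivative C' s) (at s within {0..})" if s: "0 \<le> s" for s
  proof (cases "s = 0")
    case False
    with s have "((\<lambda>s. F (a s)) has_real_derivative C' s) (at s)"
      by (intro Fa) simp
    then have "((\<lambda>s. F (a s)) has_real_derivative C' s) (at s within {0..})"
      by (rule has_field_derivative_at_within)
    then show ?thesis
    proof (rule has_field_derivative_transform_within[OF _ zero_less_one])
      show "F (a x) = C x" if "x \<in> {0..}" for x
        using C[of x] that by (simp add: a_def w_def)
    qed (use s in simp)
  next
    case True
    \<comment> \<open>The chain rule fails at 0, where the square root has no finite derivative.
      L'Hopital's rule obtains the derivative from the limit of C' instead.\<close>
    have "((\<lambda>s. (F (a s) - F 0) / s) \<longlongrightarrow> C' 0) (at_right 0)"
    proof (rule lhopital_right_0)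
      have "(F \<longlongrightarrow> F 0) (at_right 0)"
        using DERIV_isCont[OF F, of 0] by (simp add: isCont_def filterlim_at_split)
      from filterlim_compose[OF this a_lim]
      show "((\<lambda>s. F (a s) - F 0) \<longlongrightarrow> 0) (at_right 0)" by (simp add: LIM_zero)
      show "((\<lambda>s :: real. s) \<longlongrightarrow> 0) (at_right 0)" by (rule tendsto_ident_at)
      show "\<forall>\<^sub>F s in at_right 0. (s :: real) \<noteq> 0"
        using eventually_at_right_less[of "0 :: real"] by eventually_elim simp
      show "\<forall>\<^sub>F s in at_right 0. ((\<lambda>s. F (a s) - F 0) has_real_derivative C' s) (at s)"
        using eventually_at_right_less[of "0 :: real"] by eventually_elim (auto intro!: derivative_eq_intros Fa)
      show "\<forall>\<^sub>F s in at_right 0. ((\<lambda>s :: real. s) has_real_derivative 1) (at s)"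
        by simp
      show "((\<lambda>s. C' s / 1) \<longlongrightarrow> C' 0) (at_right 0)" using C'_lim by simp
    qed simp
    then have "((\<lambda>s. (C s - C 0) / (s - 0)) \<longlongrightarrow> C' 0) (at_right 0)"
      by (rule Lim_transform_eventually)
        (use eventually_at_right_less[of "0 :: real"] in eventually_elim, simp add: C a0 flip: w_def a_def)
    then show ?thesis
      using True by (simp add: has_field_derivative_iff at_within_Ici_at_right)
  qed
  moreover have "C' 0 = D\<^sup>2 / 2 * K0" by (simp add: C'_def)
  moreover
  \<comment> \<open>An exact identity that isolates the only singular contribution, K1 times a / s.
    The term 2 \<gamma>^2 + \<gamma>^4 s is (w^2 - 1) / s.\<close>
  have quot: "(C' s - C' 0) / s =
      D\<^sup>2 / 2 * (- (2 * \<gamma>\<^sup>2 + \<gamma> ^ 4 * s) * K0 / (w s)\<^sup>2 + D\<^sup>2 * (K2 + \<rho> (a s)) / w s ^ 3) +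
      K1 * (D\<^sup>2 / 2 * (a s / s / (w s)\<^sup>2))" if s: "0 < s" for s
  proof -
    have "f (a s) / a s = K0 + K1 * a s + (K2 + \<rho> (a s)) * (a s)\<^sup>2"
      using apos[OF s] by (simp add: \<rho>_def field_simps)
    also have "(a s)\<^sup>2 = D\<^sup>2 * (s / w s)" by (rule a2[OF s])
    finally have "C' s = D\<^sup>2 / (2 * (w s)\<^sup>2) * (K0 + K1 * a s + (K2 + \<rho> (a s)) * (D\<^sup>2 * (s / w s)))"
      using s by (simp add: C'_def)
    moreover have "D\<^sup>2 / 2 * K0 = D\<^sup>2 / (2 * (w s)\<^sup>2) * (K0 + (2 * \<gamma>\<^sup>2 + \<gamma> ^ 4 * s) * K0 * s)"
    proof -
      have "K0 + (2 * \<gamma>\<^sup>2 + \<gamma> ^ 4 * s) * K0 * s = K0 * (w s)\<^sup>2"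
        by (simp add: w_def power2_eq_square power4_eq_xxxx algebra_simps)
      then show ?thesis using wpos[of s] s by simp
    qed
    ultimately show ?thesis
      using s wpos[of s] by (simp add: C'_def field_simps power2_eq_square power3_eq_cube)
  qed
  have \<rho>: "((\<lambda>s. \<rho> (a s)) \<longlongrightarrow> 0) (at_right 0)"
    using filterlim_compose[OF f[unfolded expands_def, folded \<rho>_def] a_lim] .
  have regular: "((\<lambda>s. D\<^sup>2 / 2 * (- (2 * \<gamma>\<^sup>2 + \<gamma> ^ 4 * s) * K0 / (w s)\<^sup>2 + D\<^sup>2 * (K2 + \<rho> (a s)) / w s ^ 3))
      \<longlongrightarrow> D ^ 4 / 2 * K2 - D\<^sup>2 * \<gamma>\<^sup>2 * K0) (at_right 0)" (is "(?R \<longlongrightarrow> _) _")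
  proof -
    have "(?R \<longlongrightarrow> D\<^sup>2 / 2 * (- (2 * \<gamma>\<^sup>2 + \<gamma> ^ 4 * 0) * K0 / 1\<^sup>2 + D\<^sup>2 * (K2 + 0) / 1 ^ 3)) (at_right 0)"
      by (intro tendsto_intros w_lim \<rho>) simp_all
    moreover have "D\<^sup>2 / 2 * (- (2 * \<gamma>\<^sup>2 + \<gamma> ^ 4 * 0) * K0 / 1\<^sup>2 + D\<^sup>2 * (K2 + 0) / 1 ^ 3) =
        D ^ 4 / 2 * K2 - D\<^sup>2 * \<gamma>\<^sup>2 * K0"
      by (simp add: power2_eq_square power4_eq_xxxx algebra_simps)
    ultimately show ?thesis by (simp only:)
  qed
  have "(C' has_real_derivative D ^ 4 / 2 * K2 - D\<^sup>2 * \<gamma>\<^sup>2 * K0) (at 0 within {0..})" if "K1 = 0"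
  proof -
    have "((\<lambda>s. (C' s - C' 0) / (s - 0)) \<longlongrightarrow> D ^ 4 / 2 * K2 - D\<^sup>2 * \<gamma>\<^sup>2 * K0) (at_right 0)"
      using regular
      by (rule Lim_transform_eventually) (use eventually_at_right_less[of "0 :: real"] in eventually_elim, simp add: quot that)
    then show ?thesis
      by (simp add: has_field_derivative_iff at_within_Ici_at_right)
  qed
  moreover have "filterlim (\<lambda>s. (C' s - C' 0) / s) at_top (at_right 0)" if K1: "0 < K1"
  proof -
    \<comment> \<open>From a^2 = D^2 s / w follows a / s = D^2 / (a w), so the blow-up reduces to a
      w tending to 0 from above.\<close>
    have "((\<lambda>s. a s * w s) \<longlongrightarrow> 0 * 1) (at_right 0)"
      using a_lim by (intro tendsto_mult w_lim) (simp add: filterlim_at)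
    moreover have "\<forall>\<^sub>F s in at_right 0. 0 < a s * w s"
      using eventually_at_right_less[of "0 :: real"] by eventually_elim (simp add: apos wpos)
    ultimately have inv: "filterlim (\<lambda>s. inverse (a s * w s)) at_top (at_right 0)"
      by (intro filterlim_inverse_at_top) simp_all
    have "((\<lambda>s. K1 * (D\<^sup>2 / 2) * D\<^sup>2 / (w s)\<^sup>2) \<longlongrightarrow> K1 * (D\<^sup>2 / 2) * D\<^sup>2 / 1\<^sup>2) (at_right 0)"
      by (intro tendsto_intros w_lim) simp
    then have "filterlim (\<lambda>s. K1 * (D\<^sup>2 / 2) * D\<^sup>2 / (w s)\<^sup>2 * inverse (a s * w s)) at_top (at_right 0)"
      by (rule filterlim_tendsto_pos_mult_at_top[OF _ _ inv]) (use K1 D in simp)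
    from filterlim_tendsto_add_at_top[OF regular this] show ?thesis
    proof (rule filterlim_mono_eventually[OF _ order_refl order_refl])
      show "\<forall>\<^sub>F s in at_right 0. ?R s + K1 * (D\<^sup>2 / 2) * D\<^sup>2 / (w s)\<^sup>2 * inverse (a s * w s) = (C' s - C' 0) / s"
        using eventually_at_right_less[of "0 :: real"]
      proof eventually_elim
        fix s :: real assume s: "0 < s"
        have "a s / s = D\<^sup>2 * inverse (a s * w s)"
          using a2[OF s] apos[OF s] wpos[of s] s by (simp add: field_simps power2_eq_square)
        then show "?R s + K1 * (D\<^sup>2 / 2) * D\<^sup>2 / (w s)\<^sup>2 * inverse (a s * w s) = (C' s - C' 0) / s"
          unfolding quot[OF s] by simp
      qed
    qed
  qed
  ultimately show thesis by (rule that)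
qed

section \<open>Evaluation of the coefficients for each number of phases\<close>

theorem theorem3:
  fixes M :: nat and d :: complex and \<gamma> N0 :: real
  assumes "M \<ge> 2" and "d \<noteq> 0" and "N0 > 0"
  shows "\<exists>C' :: real \<Rightarrow> real.
    (\<forall>snr\<ge>0. (psk_capacity M d \<gamma> N0 has_real_derivative C' snr) (at snr within {0..})) \<and>
    C' 0 = (if M = 2 then 2 * (cmod d)\<^sup>2 / pi
            else (real M)\<^sup>2 * (cmod d)\<^sup>2 / (4 * pi) * (sin (pi / real M))\<^sup>2) \<and>
    (if M = 3 then filterlim (\<lambda>snr. (C' snr - C' 0) / snr) at_top (at_right 0)
     else (C' has_real_derivative
       (if M = 2 then
          8 / (3 * pi) * (1 / pi - 1) * (cmod d) ^ 4 - 4 * (cmod d)\<^sup>2 * \<gamma>\<^sup>2 / pi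
        else if M = 4 then
          4 / (3 * pi) * (1 / pi - 1) * (cmod d) ^ 4 - 4 * (cmod d)\<^sup>2 * \<gamma>\<^sup>2 / pi
        else
          psk_psi M * (cmod d) ^ 4
            - (cmod d)\<^sup>2 * \<gamma>\<^sup>2 / (2 * pi) * (real M)\<^sup>2 * (sin (pi / real M))\<^sup>2))
       (at 0 within {0..}))"
proof -
  define s1 s2 s3 where "s1 = sin (pi / real M)" and "s2 = sin (2 * (pi / real M))"
    and "s3 = sin (3 * (pi / real M))"
  define \<sigma> where "\<sigma> k = (if M dvd k then real M else 0)" for k
  define K0 where "K0 = real M * s1\<^sup>2 / (2 * pi) * (real M + \<sigma> 2)"
  define K1 where "K1 = real M / (pi * sqrt pi) *
    (3 / 4 * s1 * s2 * (\<sigma> 1 + \<sigma> 3) - real M / 8 * s1 ^ 3 * (3 * \<sigma> 1 + \<sigma> 3))"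
  define K2 where "K2 = real M * (s1 * (s3 * (\<sigma> 2 + \<sigma> 4) - 3 * s1 * (real M + \<sigma> 2)) / (6 * pi)
      + s2\<^sup>2 * (real M + \<sigma> 4) / (4 * pi\<^sup>2)
      - real M * s1\<^sup>2 * s2 * (real M + 2 * \<sigma> 2 + \<sigma> 4) / (4 * pi\<^sup>2)
      + (real M)\<^sup>2 * s1 ^ 4 * (3 * real M + 4 * \<sigma> 2 + \<sigma> 4) / (24 * pi\<^sup>2))"
  have M0: "0 < M" using assms(1) by simp
  have K: "expands (\<lambda>a. psk_info_deriv M a / a) K0 K1 K2"
    using expands_psk_info_deriv[OF M0]
    unfolding K0_def K1_def K2_def s1_def s2_def s3_def \<sigma>_def .
  obtain C' where C': "\<And>s. 0 \<le> s \<Longrightarrow> (psk_capacity M d \<gamma> N0 has_real_derivative C' s) (at s within {0..})"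
    and C'0: "C' 0 = (cmod d)\<^sup>2 / 2 * K0"
    and C'': "K1 = 0 \<Longrightarrow> (C' has_real_derivative cmod d ^ 4 / 2 * K2 - (cmod d)\<^sup>2 * \<gamma>\<^sup>2 * K0) (at 0 within {0..})"
    and C''_top: "0 < K1 \<Longrightarrow> filterlim (\<lambda>s. (C' s - C' 0) / s) at_top (at_right 0)"
    using has_derivatives_snr[OF DERIV_psk_info[OF M0] K, of "cmod d" "psk_capacity M d \<gamma> N0" \<gamma>]
      psk_capacity_eq_psk_info[OF assms(1,3)] assms(2) by auto
  have s2: "s2 = 2 * s1 * cos (pi / real M)" unfolding s1_def s2_def by (rule sin_double)
  have s2': "s2 = sin (2 * pi / real M)" by (simp add: s2_def)
  consider "M = 2" | "M = 3" | "M = 4" | "5 \<le> M" using assms(1) by linarith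
  then show ?thesis
  proof cases
    case 1
    \<comment> \<open>Here M divides both 2 and 4. The value of \<open>\<sigma> 2\<close> doubles
      K0, which is why even the first derivative departs from the general formula.\<close>
    have \<sigma>: "\<sigma> 1 = 0" "\<sigma> 2 = 2" "\<sigma> 3 = 0" "\<sigma> 4 = 2" by (simp_all add: \<sigma>_def 1)
    have s: "s1 = 1" "s2 = 0" "s3 = - 1"
      using sin_3over2_pi by (simp_all add: s1_def s2_def s3_def 1)
    have K: "K0 = 4 / pi" "K1 = 0" "K2 = 16 / (3 * pi) * (1 / pi - 1)"
      by (simp_all add: K0_def K1_def K2_def \<sigma> s 1 field_simps power2_eq_square del: One_nat_def)
    have "C' 0 = 2 * (cmod d)\<^sup>2 / pi"
      by (simp add: C'0 K)
    moreover have "cmod d ^ 4 / 2 * K2 - (cmod d)\<^sup>2 * \<gamma>\<^sup>2 * K0 =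
        8 / (3 * pi) * (1 / pi - 1) * cmod d ^ 4 - 4 * (cmod d)\<^sup>2 * \<gamma>\<^sup>2 / pi"
      by (simp add: K field_simps)
    ultimately show ?thesis
      using C' C''[OF K(2)] 1 by (intro exI[of _ C']) simp
  next
    case 2
    have \<sigma>: "\<sigma> 1 = 0" "\<sigma> 2 = 0" "\<sigma> 3 = 3" "\<sigma> 4 = 0" by (simp_all add: \<sigma>_def 2)
    have s: "s1 = sqrt 3 / 2" "s2 = sqrt 3 / 2"
      unfolding s2 by (simp_all add: s1_def 2 sin_60 cos_60)
    \<comment> \<open>Harmonic 3 is the only one of the four that survives, so K1 is a positive
      multiple of 4 - sqrt 3.\<close>
    have "K1 = 3 / (pi * sqrt pi) * (27 / 16 - 27 / 64 * sqrt 3)"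
      by (simp add: K1_def \<sigma> s 2 power3_eq_cube algebra_simps del: One_nat_def)
    moreover have "sqrt 3 < 4" by (rule real_less_lsqrt) simp_all
    ultimately have "0 < K1" by simp
    moreover have "C' 0 = (real M)\<^sup>2 * (cmod d)\<^sup>2 / (4 * pi) * (sin (pi / real M))\<^sup>2"
      by (simp add: C'0 K0_def \<sigma> s1_def power2_eq_square)
    ultimately show ?thesis
      using C' C''_top 2 by (intro exI[of _ C']) simp
  next
    case 3
    \<comment> \<open>Only harmonic 4 survives. It enters K2 but not K0, so the first derivative
      still follows the general formula.\<close>
    have \<sigma>: "\<sigma> 1 = 0" "\<sigma> 2 = 0" "\<sigma> 3 = 0" "\<sigma> 4 = 4" by (simp_all add: \<sigma>_def 3)
    have "s3 = 3 * s1 - 4 * s1 ^ 3" unfolding s1_def s3_def by (rule sin_treble_sin)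
    then have s: "s1 = sqrt 2 / 2" "s2 = 1" "s3 = sqrt 2 / 2"
      unfolding s2 by (simp_all add: s1_def 3 sin_45 cos_45 power3_eq_cube)
    have K: "K0 = 4 / pi" "K1 = 0" "K2 = 8 / (3 * pi) * (1 / pi - 1)"
      by (simp_all add: K0_def K1_def K2_def \<sigma> s 3 field_simps power2_eq_square power4_eq_xxxx del: One_nat_def)
    have "C' 0 = (real M)\<^sup>2 * (cmod d)\<^sup>2 / (4 * pi) * (sin (pi / real M))\<^sup>2"
      by (simp add: C'0 K0_def \<sigma> s1_def power2_eq_square)
    moreover have "cmod d ^ 4 / 2 * K2 - (cmod d)\<^sup>2 * \<gamma>\<^sup>2 * K0 =
        4 / (3 * pi) * (1 / pi - 1) * cmod d ^ 4 - 4 * (cmod d)\<^sup>2 * \<gamma>\<^sup>2 / pi"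
      by (simp add: K field_simps)
    ultimately show ?thesis
      using C' C''[OF K(2)] 3 by (intro exI[of _ C']) simp
  next
    case 4
    have \<sigma>: "\<sigma> 1 = 0" "\<sigma> 2 = 0" "\<sigma> 3 = 0" "\<sigma> 4 = 0"
      using 4 by (auto simp: \<sigma>_def dest!: dvd_imp_le)
    have K1: "K1 = 0" by (simp add: K1_def \<sigma> del: One_nat_def)
    have K0: "K0 = (real M)\<^sup>2 / (2 * pi) * s1\<^sup>2" by (simp add: K0_def \<sigma> power2_eq_square)
    have K2: "K2 = 2 * psk_psi M"
    proof -
      \<comment> \<open>The terms of \<open>psk_psi\<close> weighted by pi are -4 pi s1^2 in
        disguise; this identity, sin^2 x = sin^2 (2 x) / 4 + sin^4 x, recovers the form that K2
        takes when all the sums \<open>\<sigma> k\<close> vanish.\<close>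
      have "s1\<^sup>2 = s2\<^sup>2 / 4 + s1 ^ 4"
        unfolding s2 using sin_cos_squared_add[of "pi / real M"] s1_def by algebra
      then have "4 * pi * s1\<^sup>2 = pi * s2\<^sup>2 + 4 * pi * s1 ^ 4" by algebra
      then have "(2 - pi) * s2\<^sup>2 + ((real M)\<^sup>2 - 4 * pi) * s1 ^ 4 - 2 * real M * s1\<^sup>2 * s2 =
          2 * s2\<^sup>2 + (real M)\<^sup>2 * s1 ^ 4 - 2 * real M * s1\<^sup>2 * s2 - 4 * pi * s1\<^sup>2"
        by algebra
      then have psi: "psk_psi M = (real M)\<^sup>2 / (16 * pi\<^sup>2) *
          (2 * s2\<^sup>2 + (real M)\<^sup>2 * s1 ^ 4 - 2 * real M * s1\<^sup>2 * s2 - 4 * pi * s1\<^sup>2)"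
        by (simp only: psk_psi_def s1_def[symmetric] s2'[symmetric])
      show ?thesis
        unfolding psi by (simp add: K2_def \<sigma> field_simps power2_eq_square)
    qed
    have "C' 0 = (real M)\<^sup>2 * (cmod d)\<^sup>2 / (4 * pi) * (sin (pi / real M))\<^sup>2"
      by (simp add: C'0 K0 s1_def)
    moreover have "cmod d ^ 4 / 2 * K2 - (cmod d)\<^sup>2 * \<gamma>\<^sup>2 * K0 =
        psk_psi M * cmod d ^ 4 - (cmod d)\<^sup>2 * \<gamma>\<^sup>2 / (2 * pi) * (real M)\<^sup>2 * (sin (pi / real M))\<^sup>2"
      by (simp add: K0 K2 s1_def)
    ultimately show ?thesis
      using C' C''[OF K1] 4 by (intro exI[of _ C']) simp
  qed
qed

end
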